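(* If $r=r(n)<1/2$ and $p=p(n)$ satisfy $nr^2p \ge (\log n)^2$, then with probability tending to $1$ as $n\to\infty$, the graph $G=G(n,r,p)$ satisfies \[ \mathrm{diam}(G) = \Theta\left( r^{-1} + \frac{\log n}{\log(nr^2p)}\right). \]
   Context: The random graph $G(n,r,p)$ is defined as follows. Place $n$ points independently and uniformly at random in the unit torus $[0,1]^2$ (opposite sides identified), and join two points by an edge if their distance in the torus metric is at most $r$; this is the random geometric graph $G(n,r)$. Independently, let $G(n,p)$ be the Erdős–Rényi random graph on the same $n$ vertices, where each pair is an edge independently with probability $p$. Then $G(n,r,p)=G(n,r)\cap G(n,p)$. $\mathrm{diam}(G)$ is the graph diameter (maximum graph distance between two vertices). The $\Theta$ means bounded above and below by positive absolute constant multiples. Logarithms are natural. *)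

theory Defs
  imports "HOL-Probability.Probability" "Graph_Theory.Graph_Theory"
begin

(* Distance on the circle R/Z of two representatives s, t in [0,1]. *)
definition circle_dist :: "real \<Rightarrow> real \<Rightarrow> real" where
  "circle_dist s t = min \<bar>s - t\<bar> (1 - \<bar>s - t\<bar>)"

definition torus_dist :: "real \<times> real \<Rightarrow> real \<times> real \<Rightarrow> real" where
  "torus_dist x y = sqrt ((circle_dist (fst x) (fst y))\<^sup>2 + (circle_dist (snd x) (snd y))\<^sup>2)"

definition unit_square :: "(real \<times> real) set" where
  "unit_square = {0..1} \<times> {0..1}"

definition vertex_pairs :: "nat \<Rightarrow> nat set set" where
  "vertex_pairs n = {e. e \<subseteq> {..<n} \<and> card e = 2}"

(* Undirected simple graphs are represented as loop-free symmetric pair digraphs. *)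

definition geometric_graph :: "nat \<Rightarrow> real \<Rightarrow> (nat \<Rightarrow> real \<times> real) \<Rightarrow> nat pair_pre_digraph" where
  "geometric_graph n r X =
     \<lparr> pverts = {..<n},
       parcs = {(u, v). {u, v} \<in> vertex_pairs n \<and> torus_dist (X u) (X v) \<le> r} \<rparr>"

definition erdos_renyi_graph :: "nat \<Rightarrow> (nat set \<Rightarrow> bool) \<Rightarrow> nat pair_pre_digraph" where
  "erdos_renyi_graph n B =
     \<lparr> pverts = {..<n},
       parcs = {(u, v). {u, v} \<in> vertex_pairs n \<and> B {u, v}} \<rparr>"

definition grp_graph ::
    "nat \<Rightarrow> real \<Rightarrow> (nat \<Rightarrow> real \<times> real) \<times> (nat set \<Rightarrow> bool) \<Rightarrow> nat pair_pre_digraph" where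
  "grp_graph n r \<omega> =
     \<lparr> pverts = {..<n},
       parcs = parcs (geometric_graph n r (fst \<omega>)) \<inter> parcs (erdos_renyi_graph n (snd \<omega>)) \<rparr>"

(* The law of the n independent uniform points together with, independently of them, the
   independent Bernoulli(p) indicators of the pairs of vertices; the random graph G(n,r,p)
   is the random variable grp_graph n r on this space. *)
definition grp_space :: "nat \<Rightarrow> real \<Rightarrow> ((nat \<Rightarrow> real \<times> real) \<times> (nat set \<Rightarrow> bool)) measure" where
  "grp_space n p =
     PiM {..<n} (\<lambda>_. uniform_measure lborel unit_square) \<Otimes>\<^sub>M
     PiM (vertex_pairs n) (\<lambda>_. measure_pmf (bernoulli_pmf p))"

(* With unit weights, \<mu> is the minimal number of edges of a walk, so it is infinite for
   vertices in different components. *)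
definition graph_diam :: "('a, 'b) pre_digraph \<Rightarrow> ereal" where
  "graph_diam G = (SUP u \<in> verts G. SUP v \<in> verts G. wf_digraph.\<mu> G (\<lambda>_. 1) u v)"

lemma pair_graph_grp_graph: "pair_graph (grp_graph n r \<omega>)"
proof -
  have "torus_dist x y = torus_dist y x" for x y
    by (simp add: torus_dist_def circle_dist_def abs_minus_commute)
  then show ?thesis
    by unfold_locales
       (auto simp: grp_graph_def geometric_graph_def erdos_renyi_graph_def vertex_pairs_def
          insert_commute symmetric_def sym_def arcs_ends_def arc_to_ends_def
          intro: finite_subset[of _ "{..<n} \<times> {..<n}"])
qed

lemma prob_space_grp_space: "prob_space (grp_space n p)"
proof -
  have "emeasure lborel unit_square = 1"
    by (simp add: unit_square_def lborel_prod[symmetric] lborel.emeasure_pair_measure_Times)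
  then have "prob_space (uniform_measure lborel unit_square)"
    by (intro prob_space_uniform_measure) auto
  then have "prob_space (PiM {..<n} (\<lambda>_. uniform_measure lborel unit_square))"
    by (intro prob_space_PiM)
  moreover have "prob_space (PiM (vertex_pairs n) (\<lambda>_. measure_pmf (bernoulli_pmf p)))"
    by (intro prob_space_PiM measure_pmf.prob_space_axioms)
  ultimately show ?thesis
    unfolding grp_space_def by (rule prob_space_pair)
qed

end

theory Submission
  imports Defs "HOL-Real_Asymp.Real_Asymp"
begin

text \<open>Cut the torus into \<open>m\<^sup>2\<close> boxes, where \<open>m = \<lceil>3 / r\<rceil>\<close>, so that points of adjacent
boxes are within distance \<open>r\<close>. A Chernoff bound puts at least \<open>M = n / (4 m\<^sup>2)\<close> points in every box.
Condition on such a point set and write \<open>L = ln n\<close>. A union bound over all set pairs shows that a set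
of \<open>s \<le> 2 L / p\<close> vertices has more than \<open>g s\<close> neighbours in an adjacent box, where
\<open>g = M p / (4 L)\<close>; the hypothesis \<open>n r\<^sup>2 p \<ge> L\<^sup>2\<close> makes \<open>g\<close> at least a fixed power of \<open>n r\<^sup>2 p\<close>.
It also shows that any two disjoint sets of \<open>k \<approx> 4 L / p\<close> vertices are joined by an edge of \<open>G(n,p)\<close>.
Hence from any vertex \<open>O(L / ln g)\<close> steps reach \<open>k\<close> vertices of a single box, each further step carries
\<open>k\<close> reached vertices into any prescribed adjacent box, and so after \<open>O(1 / r)\<close> more steps the reached
sets of two vertices are in adjacent boxes and are joined by an edge.

For the lower bound, two points at horizontal distance at least \<open>1 / 4\<close> need \<open>1 / (4 r)\<close> steps, and the
expected number of paths of length at most \<open>h\<close> between two given vertices is at most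
\<open>h (16 n r\<^sup>2 p)\<^sup>h / n\<close>.\<close>

section \<open>Distances in graphs\<close>

text \<open>All path arguments run on powers of the arc relation; this lemma and its converse below
  connect them with the arc walks over which \<open>\<mu>\<close> minimises.\<close>

lemma relpow_imp_awalk:
  assumes G: "wf_digraph (with_proj G)" and "u \<in> pverts G" "(u, v) \<in> parcs G ^^ k"
  shows "\<exists>p. pre_digraph.awalk (with_proj G) u p v \<and> length p = k"
proof -
  interpret wf_digraph "with_proj G" by (fact G)
  show ?thesis
    using assms(2,3)
  proof (induction k arbitrary: u)
    case 0
    then show ?case by (auto simp: awalk_Nil_iff)
  next
    case (Suc k)
    then obtain w where w: "(u, w) \<in> parcs G" "(w, v) \<in> parcs G ^^ k"
      by (meson relpow_Suc_D2)
    then have "w \<in> pverts G" using head_in_verts[of "(u, w)"] by simp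
    with Suc.IH w obtain p where "awalk w p v" "length p = k" by blast
    then have "awalk u ((u, w) # p) v" using w by (simp add: awalk_Cons_iff)
    then show ?case using \<open>length p = k\<close> by (intro exI[of _ "(u, w) # p"]) auto
  qed
qed

lemma awalk_imp_relpow:
  assumes G: "wf_digraph (with_proj G)" and "pre_digraph.awalk (with_proj G) u p v"
  shows "(u, v) \<in> parcs G ^^ length p"
proof -
  interpret wf_digraph "with_proj G" by (fact G)
  show ?thesis
    using assms(2)
  proof (induction p arbitrary: u)
    case Nil
    then show ?case by (simp add: awalk_Nil_iff)
  next
    case (Cons e p)
    then have "(u, snd e) \<in> parcs G" "(snd e, v) \<in> parcs G ^^ length p"
      by (auto simp: awalk_Cons_iff)
    then have "(u, v) \<in> parcs G ^^ Suc (length p)" by (rule relpow_Suc_I2)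
    then show ?case by simp
  qed
qed

lemma graph_diam_le:
  assumes G: "wf_digraph (with_proj G)"
    and "\<And>u v. u \<in> pverts G \<Longrightarrow> v \<in> pverts G \<Longrightarrow> \<exists>i. real i \<le> K \<and> (u, v) \<in> parcs G ^^ i"
  shows "graph_diam (with_proj G) \<le> ereal K"
proof -
  interpret wf_digraph "with_proj G" by (fact G)
  have "\<mu> (\<lambda>_. 1) u v \<le> ereal K" if uv: "u \<in> pverts G" "v \<in> pverts G" for u v
  proof -
    obtain i where i: "real i \<le> K" "(u, v) \<in> parcs G ^^ i" using assms(2)[OF uv] by blast
    obtain p where "awalk u p v" "length p = i" using relpow_imp_awalk[OF G uv(1) i(2)] by blast
    moreover from this have "awalk_cost (\<lambda>_. 1) p = real i"
      by (simp add: awalk_cost_def sum_list_triv)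
    ultimately show ?thesis
      using min_cost_le_walk_cost[of u p v "\<lambda>_. 1"] i(1) by (metis order_trans ereal_less_eq(3))
  qed
  then show ?thesis unfolding graph_diam_def by (auto intro!: SUP_least)
qed

text \<open>If \<open>u\<close> and \<open>v\<close> lie in different components, the last
  hypothesis is vacuous, which agrees with \<open>\<mu>\<close> being an infimum over the empty set,
  that is, infinite.\<close>

lemma graph_diam_ge:
  assumes G: "wf_digraph (with_proj G)" and uv: "u \<in> pverts G" "v \<in> pverts G"
    and "\<And>i. (u, v) \<in> parcs G ^^ i \<Longrightarrow> K \<le> real i"
  shows "ereal K \<le> graph_diam (with_proj G)"
proof -
  interpret wf_digraph "with_proj G" by (fact G)
  have "ereal K \<le> \<mu> (\<lambda>_. 1) u v"
    unfolding \<mu>_def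
  proof (intro INF_greatest)
    fix p assume "p \<in> {p. awalk u p v}"
    then have "(u, v) \<in> parcs G ^^ length p" using awalk_imp_relpow[OF G] by blast
    then have "K \<le> real (length p)" by (rule assms(4))
    then show "ereal K \<le> ereal (awalk_cost (\<lambda>_. 1) p)"
      by (simp add: awalk_cost_def sum_list_triv)
  qed
  also have "\<dots> \<le> (SUP v\<in>pverts G. \<mu> (\<lambda>_. 1) u v)" using uv by (intro SUP_upper)
  also have "\<dots> \<le> graph_diam (with_proj G)"
    unfolding graph_diam_def with_proj_simps using uv by (intro SUP_upper)
  finally show ?thesis .
qed

text \<open>If the new first vertex already occurs on the path built so far, the path is cut to
  start at that occurrence. Distinct vertices matter because the probability of a path factorises
  only when its points and edges are independent.\<close>

lemma relpow_imp_distinct_path: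
  assumes "(u, v) \<in> E ^^ k"
  shows "\<exists>xs. distinct (u # xs) \<and> length xs \<le> k \<and> last (u # xs) = v \<and>
           successively (\<lambda>x y. (x, y) \<in> E) (u # xs)"
  using assms
proof (induction k arbitrary: u)
  case 0
  then show ?case by (intro exI[of _ "[]"]) auto
next
  case (Suc k)
  then obtain w where w: "(u, w) \<in> E" "(w, v) \<in> E ^^ k"
    by (meson relpow_Suc_D2)
  from Suc.IH[OF w(2)] obtain xs where xs: "distinct (w # xs)" "length xs \<le> k"
    "last (w # xs) = v" "successively (\<lambda>x y. (x, y) \<in> E) (w # xs)" by blast
  show ?case
  proof (cases "u \<in> set (w # xs)")
    case False
    then show ?thesis using xs w by (intro exI[of _ "w # xs"]) auto
  next
    case True
    then obtain ys zs where yz: "w # xs = ys @ u # zs" by (meson split_list)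
    have "length (w # xs) = length (ys @ u # zs)" using yz by simp
    then have "length zs \<le> Suc k" using xs by simp
    moreover have "distinct (u # zs)" using xs(1) yz by simp
    moreover have "last (u # zs) = v" using xs(3) yz by simp
    moreover have "successively (\<lambda>x y. (x, y) \<in> E) (u # zs)"
      using xs(4) yz by (simp add: successively_append_iff)
    ultimately show ?thesis by blast
  qed
qed

section \<open>Balls around a vertex in the graph metric\<close>

definition reach :: "('a \<times> 'a) set \<Rightarrow> 'a \<Rightarrow> nat \<Rightarrow> 'a set" where
  "reach E u j = {v. \<exists>i\<le>j. (u, v) \<in> E ^^ i}"

lemma reach_0: "u \<in> reach E u 0"
  by (auto simp: reach_def)

lemma reach_Suc: "v \<in> reach E u j \<Longrightarrow> (v, w) \<in> E \<Longrightarrow> w \<in> reach E u (Suc j)"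
  unfolding reach_def by (auto intro: relpow_Suc_I)

lemma reach_mono: "i \<le> j \<Longrightarrow> reach E u i \<subseteq> reach E u j"
  unfolding reach_def by (auto intro: order_trans)

lemma reach_sym:
  assumes "sym E" "v \<in> reach E u j"
  shows "u \<in> reach E v j"
proof -
  have "(v, u) \<in> E ^^ i" if "(u, v) \<in> E ^^ i" for i
    using that
  proof (induction i arbitrary: v)
    case (Suc i)
    then obtain w where "(u, w) \<in> E ^^ i" "(w, v) \<in> E" by auto
    then show ?case using Suc.IH[of w] assms(1) by (meson relpow_Suc_I2 symE)
  qed auto
  then show ?thesis using assms(2) by (auto simp: reach_def)
qed

lemma reach_trans:
  assumes "v \<in> reach E u i" "w \<in> reach E v j"
  shows "w \<in> reach E u (i + j)"
proof -
  obtain a b where "a \<le> i" "b \<le> j" "(u, v) \<in> E ^^ a" "(v, w) \<in> E ^^ b"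
    using assms by (auto simp: reach_def)
  then show ?thesis unfolding reach_def
    by (auto intro!: exI[of _ "a + b"] simp: relpow_add)
qed

section \<open>Edges between vertex sets\<close>

abbreviation bit_space :: "nat \<Rightarrow> real \<Rightarrow> (nat set \<Rightarrow> bool) measure" where
  "bit_space n p \<equiv> PiM (vertex_pairs n) (\<lambda>_. measure_pmf (bernoulli_pmf p))"

lemma finite_vertex_pairs: "finite (vertex_pairs n)"
  by (rule finite_subset[of _ "Pow {..<n}"]) (auto simp: vertex_pairs_def)

lemma prob_space_bit_space: "prob_space (bit_space n p)"
  by (intro prob_space_PiM measure_pmf.prob_space_axioms)

lemma bit_event_sets:
  assumes "J \<subseteq> vertex_pairs n"
  shows "{B \<in> space (bit_space n p). \<forall>e\<in>J. B e = b} \<in> sets (bit_space n p)"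
proof -
  have "{B \<in> space (bit_space n p). B e = b} \<in> sets (bit_space n p)" if "e \<in> J" for e
    by (rule sets_Collect_single') (use that assms in auto)
  then show ?thesis
    using finite_subset[OF assms finite_vertex_pairs] by (intro sets.sets_Collect_finite_All) auto
qed

text \<open>The flag \<open>b\<close> serves two uses: \<open>False\<close> for the missing edges
  between two sets, \<open>True\<close> for the edges of a path.\<close>

lemma measure_bit_event:
  assumes "J \<subseteq> vertex_pairs n" "0 \<le> p" "p \<le> 1"
  shows "measure (bit_space n p) {B \<in> space (bit_space n p). \<forall>e\<in>J. B e = b} =
    (if b then p else 1 - p) ^ card J"
proof -
  interpret product_prob_space "\<lambda>_. measure_pmf (bernoulli_pmf p)" "vertex_pairs n"
    by standard
  have fin: "finite J" using finite_subset[OF assms(1) finite_vertex_pairs] .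
  have "emeasure (bit_space n p) {B \<in> space (bit_space n p). \<forall>e\<in>J. B e \<in> {b}} =
      (\<Prod>e\<in>J. emeasure (measure_pmf (bernoulli_pmf p)) {b})"
    by (rule emeasure_PiM_Collect) (use assms fin in auto)
  also have "emeasure (measure_pmf (bernoulli_pmf p)) {b} = ennreal (if b then p else 1 - p)"
    using assms by (simp add: emeasure_pmf_single)
  finally show ?thesis using assms by (simp add: measure_def ennreal_power)
qed

definition no_edge :: "(nat set \<Rightarrow> bool) \<Rightarrow> nat set \<Rightarrow> nat set \<Rightarrow> bool" where
  "no_edge B S U \<longleftrightarrow> (\<forall>u\<in>S. \<forall>v\<in>U. \<not> B {u, v})"

text \<open>Disjointness of \<open>S\<close> and \<open>U\<close> makes
  \<open>(u, v) \<mapsto> {u, v}\<close> injective on the product, so the event forces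
  \<open>card S * card U\<close> independent bits to be false; then
  \<open>1 - p \<le> exp (- p)\<close>.\<close>

lemma
  assumes SU: "S \<subseteq> {..<n}" "U \<subseteq> {..<n}" "S \<inter> U = {}" and p: "0 \<le> p" "p \<le> 1"
  shows no_edge_sets: "{B \<in> space (bit_space n p). no_edge B S U} \<in> sets (bit_space n p)"
    and measure_no_edge: "measure (bit_space n p) {B \<in> space (bit_space n p). no_edge B S U} \<le>
      exp (- p * real (card S) * real (card U))"
proof -
  define J where "J = (\<lambda>(u, v). {u, v}) ` (S \<times> U)"
  have J: "J \<subseteq> vertex_pairs n"
    using SU by (auto simp: J_def vertex_pairs_def card_2_iff) blast
  have eq: "{B \<in> space (bit_space n p). no_edge B S U} =
      {B \<in> space (bit_space n p). \<forall>e\<in>J. B e = False}"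
    by (auto simp: no_edge_def J_def)
  show "{B \<in> space (bit_space n p). no_edge B S U} \<in> sets (bit_space n p)"
    unfolding eq by (rule bit_event_sets[OF J])
  have "inj_on (\<lambda>(u, v). {u, v}) (S \<times> U)"
    using SU(3) by (auto simp: inj_on_def doubleton_eq_iff)
  then have "card J = card S * card U"
    by (simp add: J_def card_image card_cartesian_product)
  then have "measure (bit_space n p) {B \<in> space (bit_space n p). no_edge B S U} =
      (1 - p) ^ (card S * card U)"
    unfolding eq using measure_bit_event[OF J p, of False] by simp
  also have "\<dots> \<le> exp (- p) ^ (card S * card U)"
    using exp_ge_add_one_self[of "-p"] p by (intro power_mono) auto
  also have "\<dots> = exp (- p * real (card S) * real (card U))"
    by (simp flip: exp_of_nat_mult add: algebra_simps)
  finally show "measure (bit_space n p) {B \<in> space (bit_space n p). no_edge B S U} \<le>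
      exp (- p * real (card S) * real (card U))" .
qed

lemma sum_Pow_power_card:
  fixes x :: "'b :: comm_semiring_1"
  assumes "finite A"
  shows "(\<Sum>S\<in>Pow A. x ^ card S) = (1 + x) ^ card A"
  using assms
proof (induction A rule: finite_induct)
  case (insert a A)
  have inj: "inj_on (insert a) (Pow A)"
    using insert.hyps by (auto simp: inj_on_def insert_ident dest!: subsetD)
  have "(\<Sum>S\<in>Pow (insert a A). x ^ card S) =
      (\<Sum>S\<in>Pow A. x ^ card S) + (\<Sum>S\<in>insert a ` Pow A. x ^ card S)"
    unfolding Pow_insert using insert.hyps by (intro sum.union_disjoint) auto
  also have "(\<Sum>S\<in>insert a ` Pow A. x ^ card S) = (\<Sum>S\<in>Pow A. x ^ card (insert a S))"
    by (simp add: sum.reindex[OF inj])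
  also have "\<dots> = (\<Sum>S\<in>Pow A. x * x ^ card S)"
  proof (rule sum.cong[OF refl])
    fix S assume "S \<in> Pow A"
    then have "finite S" "a \<notin> S" using insert.hyps finite_subset by auto
    then show "x ^ card (insert a S) = x * x ^ card S" by simp
  qed
  finally show ?case
    using insert by (simp add: sum_distrib_left[symmetric] algebra_simps)
qed auto

text \<open>Giving each set \<open>S\<close> the weight \<open>1 / n ^ card S\<close> keeps the
  total weight of all subsets bounded, by \<open>exp 1\<close>. A union bound over sets of every
  size can thus be done at once, without binomial coefficients.\<close>

lemma sum_Pow_inverse_power_le:
  assumes "n \<ge> 1"
  shows "(\<Sum>S\<in>Pow {..<n}. (1 / real n) ^ card S) \<le> 3"
proof -
  have "(\<Sum>S\<in>Pow {..<n}. (1 / real n) ^ card S) = (1 + 1 / real n) ^ n"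
    by (simp add: sum_Pow_power_card)
  also have "\<dots> \<le> exp (1 / real n) ^ n"
    by (intro power_mono) auto
  also have "\<dots> = exp 1"
    using assms by (simp flip: exp_of_nat_mult)
  finally show ?thesis using exp_le by linarith
qed

text \<open>The hypothesis on \<open>U C T\<close> bounds each summand by \<open>1 / n ^ (card S + card T + 2)\<close>, and
these bounds sum to at most \<open>9 / n\<^sup>2\<close> over all pairs \<open>(S, T)\<close>.\<close>

lemma measure_UN_no_edge_le:
  assumes n: "n \<ge> 1" and p: "0 \<le> p" "p \<le> 1" and "finite F"
    and I: "I \<subseteq> F \<times> Pow {..<n} \<times> Pow {..<n}"
    and sub: "\<And>C S T. (C, S, T) \<in> I \<Longrightarrow> U C T \<subseteq> {..<n} \<and> S \<inter> U C T = {}"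
    and bd: "\<And>C S T. (C, S, T) \<in> I \<Longrightarrow>
      (real (card S) + real (card T) + 2) * ln (real n) \<le> p * real (card S) * real (card (U C T))"
  shows "(\<Union>(C, S, T)\<in>I. {B \<in> space (bit_space n p). no_edge B S (U C T)}) \<in> sets (bit_space n p)"
    and "measure (bit_space n p)
      (\<Union>(C, S, T)\<in>I. {B \<in> space (bit_space n p). no_edge B S (U C T)}) \<le> 9 * real (card F) / (real n)\<^sup>2"
proof -
  interpret prob_space "bit_space n p" by (rule prob_space_bit_space)
  let ?A = "\<lambda>(C, S, T). {B \<in> space (bit_space n p). no_edge B S (U C T)}"
  have fin: "finite I" using \<open>finite F\<close> by (intro finite_subset[OF I]) auto
  have A: "?A i \<in> sets (bit_space n p)" if i: "i \<in> I" for i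
  proof -
    obtain C S T where "i = (C, S, T)" by (cases i)
    then show ?thesis using i sub[of C S T] I by (auto intro!: no_edge_sets p)
  qed
  then show "\<Union>(?A ` I) \<in> sets (bit_space n p)" using fin by auto
  let ?f = "\<lambda>(C, S, T). (1 / real n) ^ card S * (1 / real n) ^ card T / (real n)\<^sup>2"
  have bound: "prob (?A i) \<le> ?f i" if i: "i \<in> I" for i
  proof -
    obtain C S T where eq: "i = (C, S, T)" by (cases i)
    have "prob (?A i) \<le> exp (- p * real (card S) * real (card (U C T)))"
      using i sub[of C S T] I eq measure_no_edge[of S n "U C T" p] p by auto
    also have "\<dots> \<le> exp (- ((real (card S) + real (card T) + 2) * ln (real n)))"
      using bd[of C S T] i eq by simp
    also have "\<dots> = exp (- ln (real n)) ^ card S * exp (- ln (real n)) ^ card T * exp (- ln (real n)) ^ 2"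
      unfolding exp_of_nat_mult[symmetric] exp_add[symmetric] by (simp add: algebra_simps)
    also have "exp (- ln (real n)) = 1 / real n" using n by (simp add: exp_minus field_simps)
    finally show ?thesis by (simp add: eq power_divide)
  qed
  have "prob (\<Union>(?A ` I)) \<le> (\<Sum>i\<in>I. prob (?A i))"
    using A fin by (intro finite_measure_subadditive_finite) auto
  also have "\<dots> \<le> (\<Sum>i\<in>I. ?f i)" by (intro sum_mono bound)
  also have "\<dots> \<le> (\<Sum>i\<in>F \<times> Pow {..<n} \<times> Pow {..<n}. ?f i)"
    using \<open>finite F\<close> by (intro sum_mono2 I) auto
  also have "\<dots> = (\<Sum>C\<in>F. \<Sum>ST\<in>Pow {..<n} \<times> Pow {..<n}. ?f (C, ST))"
    by (subst sum.cartesian_product) (auto intro!: sum.cong)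
  also have "\<dots> = (\<Sum>C\<in>F. (\<Sum>S\<in>Pow {..<n}. \<Sum>T\<in>Pow {..<n}. (1 / real n) ^ card S * (1 / real n) ^ card T / (real n)\<^sup>2))"
    by (subst sum.cartesian_product) (auto intro!: sum.cong)
  also have "\<dots> = real (card F) * ((\<Sum>S\<in>Pow {..<n}. (1 / real n) ^ card S) * (\<Sum>S\<in>Pow {..<n}. (1 / real n) ^ card S)) / (real n)\<^sup>2"
  proof -
    have "(\<Sum>S\<in>Pow {..<n}. \<Sum>T\<in>Pow {..<n}. (1 / real n) ^ card S * (1 / real n) ^ card T / (real n)\<^sup>2) =
        (\<Sum>S\<in>Pow {..<n}. (1 / real n) ^ card S) * (\<Sum>S\<in>Pow {..<n}. (1 / real n) ^ card S) / (real n)\<^sup>2"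
      unfolding sum_product sum_divide_distrib ..
    then show ?thesis by simp
  qed
  also have "\<dots> \<le> real (card F) * (3 * 3) / (real n)\<^sup>2"
    using sum_Pow_inverse_power_le[OF n]
    by (intro divide_right_mono mult_left_mono mult_mono) (auto intro!: sum_nonneg)
  finally show "prob (\<Union>(?A ` I)) \<le> 9 * real (card F) / (real n)\<^sup>2" by (simp add: mult_ac)
qed

section \<open>Walks through expanding cells\<close>

text \<open>Adjacency in the planar grid, without wrap-around: the walks between cells stay inside
  the square.\<close>

fun grid_adj :: "nat \<times> nat \<Rightarrow> nat \<times> nat \<Rightarrow> bool" where
  "grid_adj (i, j) (i', j') \<longleftrightarrow>
     i = i' \<and> (j = Suc j' \<or> j' = Suc j) \<or> j = j' \<and> (i = Suc i' \<or> i' = Suc i)"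

lemma grid_adj_neq: "grid_adj c d \<Longrightarrow> c \<noteq> d"
  by (cases c; cases d) auto

text \<open>The deterministic content of the upper bound. \<open>expand\<close> says that at most
  \<open>2 * L\<close> vertices outside a cell have more than \<open>g\<close> times as many
  neighbours in it; it is phrased through a set \<open>T\<close> containing all these neighbours, so
  that its failure is a \<open>no_edge\<close> event. \<open>dense\<close> joins any two disjoint
  sets of size \<open>k\<close>. The bound \<open>k \<le> g * L\<close> lets one expansion step lead
  from \<open>L\<close> to \<open>k\<close> reached vertices, and \<open>large\<close> leaves
  \<open>k\<close> vertices of a cell after fewer than \<open>k\<close> are discarded.\<close>

locale expanding_cells =
  fixes n m k :: nat and E :: "(nat \<times> nat) set" and B :: "nat set \<Rightarrow> bool"
    and cell :: "nat \<times> nat \<Rightarrow> nat set" and g L :: real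
  assumes sym: "sym E"
    and cell_subset: "\<And>c. cell c \<subseteq> {..<n}"
    and cover: "\<And>u. u < n \<Longrightarrow> \<exists>c\<in>{..<m} \<times> {..<m}. u \<in> cell c"
    and disjoint: "\<And>c d. c \<noteq> d \<Longrightarrow> cell c \<inter> cell d = {}"
    and edge: "\<And>c d u v. grid_adj c d \<Longrightarrow> u \<in> cell c \<Longrightarrow> v \<in> cell d \<Longrightarrow> B {u, v} \<Longrightarrow> (u, v) \<in> E"
    and expand: "\<And>c S T. c \<in> {..<m} \<times> {..<m} \<Longrightarrow> S \<subseteq> {..<n} - cell c \<Longrightarrow> T \<subseteq> cell c \<Longrightarrow> S \<noteq> {} \<Longrightarrow>
      real (card S) \<le> 2 * L \<Longrightarrow> real (card T) \<le> g * real (card S) \<Longrightarrow> \<not> no_edge B S (cell c - T)"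
    and dense: "\<And>S U. S \<subseteq> {..<n} \<Longrightarrow> U \<subseteq> {..<n} \<Longrightarrow> S \<inter> U = {} \<Longrightarrow> card S = k \<Longrightarrow> card U = k \<Longrightarrow>
      \<not> no_edge B S U"
    and large: "\<And>c. c \<in> {..<m} \<times> {..<m} \<Longrightarrow> 2 * k \<le> card (cell c)"
    and m: "2 \<le> m" and g: "1 \<le> g" and L: "1 \<le> L" and k: "real k \<le> g * L"
begin

lemma finite_cell: "finite (cell c)"
  using cell_subset finite_subset by blast

lemma neighbours_reach:
  assumes "grid_adj c d" "S \<subseteq> reach E u j \<inter> cell c"
  shows "{v \<in> cell d. \<exists>w\<in>S. B {w, v}} \<subseteq> reach E u (Suc j) \<inter> cell d"
  using assms by (auto intro: reach_Suc edge)

text \<open>With \<open>T\<close> taken to be the set of neighbours of \<open>S\<close> in the cell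
  \<open>d\<close>, there is no edge from \<open>S\<close> to the rest of \<open>d\<close>, so
  \<open>expand\<close> rules out a small \<open>T\<close>.\<close>

lemma neighbours_expand:
  assumes "grid_adj c d" "d \<in> {..<m} \<times> {..<m}" "S \<subseteq> cell c" "S \<noteq> {}" "real (card S) \<le> 2 * L"
  shows "g * real (card S) < real (card {v \<in> cell d. \<exists>w\<in>S. B {w, v}})"
proof (rule ccontr)
  let ?T = "{v \<in> cell d. \<exists>w\<in>S. B {w, v}}"
  assume "\<not> ?thesis"
  moreover have "S \<subseteq> {..<n} - cell d"
    using assms cell_subset[of c] disjoint[of c d] grid_adj_neq by blast
  ultimately have "\<not> no_edge B S (cell d - ?T)"
    using assms by (intro expand) auto
  then show False by (auto simp: no_edge_def)
qed

lemma exists_neighbour: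
  assumes "c \<in> {..<m} \<times> {..<m}"
  shows "\<exists>d\<in>{..<m} \<times> {..<m}. grid_adj c d"
proof -
  obtain i j where c: "c = (i, j)" by (cases c)
  show ?thesis
  proof (cases i)
    case 0
    then show ?thesis using assms m c by (intro bexI[of _ "(Suc i, j)"]) auto
  next
    case (Suc i')
    then show ?thesis using assms c by (intro bexI[of _ "(i', j)"]) auto
  qed
qed

text \<open>The lower bound \<open>x\<close> is real, so that iterating the step multiplies it by
  exactly \<open>g\<close> each time and no rounding accumulates.\<close>

lemma expand_step:
  assumes c: "c \<in> {..<m} \<times> {..<m}" and x: "x \<le> real (card (reach E u j \<inter> cell c))"
    "0 < x" "x \<le> L"
  shows "\<exists>d\<in>{..<m} \<times> {..<m}. g * x \<le> real (card (reach E u (Suc j) \<inter> cell d))"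
proof -
  have "nat \<lceil>x\<rceil> \<le> card (reach E u j \<inter> cell c)" using x by linarith
  then obtain S where S: "S \<subseteq> reach E u j \<inter> cell c" "card S = nat \<lceil>x\<rceil>"
    by (meson obtain_subset_with_card_n)
  obtain d where d: "d \<in> {..<m} \<times> {..<m}" "grid_adj c d" using exists_neighbour[OF c] by blast
  \<comment> \<open>Rounding \<open>x \<le> L\<close> up adds less than 1, and
    \<open>1 \<le> L\<close>; this is why \<open>expand\<close> is assumed up to
    \<open>2 * L\<close>.\<close>
  have "real (card S) \<le> 2 * L" using S x L by linarith
  moreover have "0 < card S" using S x by linarith
  then have "S \<noteq> {}" by auto
  ultimately have "g * real (card S) < real (card {v \<in> cell d. \<exists>w\<in>S. B {w, v}})"
    using S d by (intro neighbours_expand) auto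
  also have "\<dots> \<le> real (card (reach E u (Suc j) \<inter> cell d))"
    using neighbours_reach[OF d(2) S(1)]
    by (intro of_nat_mono card_mono finite_Int disjI2 finite_cell) auto
  finally have "g * real (card S) \<le> real (card (reach E u (Suc j) \<inter> cell d))" by simp
  moreover have "g * x \<le> g * real (card S)"
    using S g by (intro mult_left_mono) linarith+
  ultimately show ?thesis using d by (intro bexI[of _ d]) auto
qed

lemma grow:
  assumes "u < n"
  shows "\<exists>c\<in>{..<m} \<times> {..<m}. min (g ^ j) L \<le> real (card (reach E u j \<inter> cell c))"
proof (induction j)
  case 0
  obtain c where c: "c \<in> {..<m} \<times> {..<m}" "u \<in> cell c" using cover[OF assms] by blast
  then have "{u} \<subseteq> reach E u 0 \<inter> cell c" by (auto intro: reach_0)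
  then have "card {u} \<le> card (reach E u 0 \<inter> cell c)" using finite_cell by (intro card_mono) auto
  then have "min (g ^ 0) L \<le> real (card (reach E u 0 \<inter> cell c))" using L by simp
  with c show ?case by blast
next
  case (Suc j)
  then obtain c where c: "c \<in> {..<m} \<times> {..<m}"
    "min (g ^ j) L \<le> real (card (reach E u j \<inter> cell c))" by blast
  have pos: "0 < min (g ^ j) L" using g L by auto
  obtain d where d: "d \<in> {..<m} \<times> {..<m}"
    "g * min (g ^ j) L \<le> real (card (reach E u (Suc j) \<inter> cell d))"
    using expand_step[OF c pos] by auto
  \<comment> \<open>Once the bound has reached \<open>L\<close>, a further step does not lose
    it.\<close>
  have "L \<le> g * L" using mult_right_mono[of 1 g L] g L by auto
  then have "min (g ^ Suc j) L \<le> g * min (g ^ j) L"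
    by (auto simp: min_def)
  with d show ?case by (meson order_trans)
qed

definition spread :: "nat \<Rightarrow> nat \<Rightarrow> nat \<times> nat \<Rightarrow> bool" where
  "spread u j c \<longleftrightarrow> k \<le> card (reach E u j \<inter> cell c)"

text \<open>After \<open>J\<close> steps some cell contains \<open>L\<close> reached vertices; one
  more expansion yields \<open>g * L \<ge> k\<close>.\<close>

lemma spread_exists:
  assumes "u < n" "L \<le> g ^ J"
  shows "\<exists>c\<in>{..<m} \<times> {..<m}. spread u (Suc J) c"
proof -
  obtain c where c: "c \<in> {..<m} \<times> {..<m}" "L \<le> real (card (reach E u J \<inter> cell c))"
    using grow[OF assms(1), of J] assms(2) by auto
  obtain d where d: "d \<in> {..<m} \<times> {..<m}" "g * L \<le> real (card (reach E u (Suc J) \<inter> cell d))"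
    using expand_step[OF c] L by auto
  then show ?thesis unfolding spread_def using k by (intro bexI[of _ d]) linarith+
qed

text \<open>Let \<open>S\<close> be \<open>k\<close> reached vertices of \<open>c\<close>. The
  vertices of \<open>d\<close> without a neighbour in \<open>S\<close> number fewer than
  \<open>k\<close>, as otherwise \<open>k\<close> of them would contradict \<open>dense\<close>.
  Since \<open>d\<close> has at least \<open>2 * k\<close> vertices, at least \<open>k\<close> of
  them are reached. Unlike in \<open>expand_step\<close>, the target cell \<open>d\<close> can be
  prescribed.\<close>

lemma spread_step:
  assumes "spread u j c" "grid_adj c d" "d \<in> {..<m} \<times> {..<m}"
  shows "spread u (Suc j) d"
proof -
  obtain S where S: "S \<subseteq> reach E u j \<inter> cell c" "card S = k"
    using assms(1) unfolding spread_def by (meson obtain_subset_with_card_n)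
  let ?T = "{v \<in> cell d. \<exists>w\<in>S. B {w, v}}"
  have "card (cell d - ?T) < k"
  proof (rule ccontr)
    assume "\<not> ?thesis"
    then obtain U where U: "U \<subseteq> cell d - ?T" "card U = k"
      by (meson not_less obtain_subset_with_card_n)
    then have "no_edge B S U" by (auto simp: no_edge_def)
    moreover have "S \<inter> U = {}"
      using S U disjoint[of c d] grid_adj_neq[OF assms(2)] by blast
    ultimately show False
      using dense[of S U] S U cell_subset[of c] cell_subset[of d] by blast
  qed
  moreover have "card (cell d - ?T) = card (cell d) - card ?T"
    using finite_cell by (intro card_Diff_subset) auto
  ultimately have "k \<le> card ?T" using large[OF assms(3)] by linarith
  also have "\<dots> \<le> card (reach E u (Suc j) \<inter> cell d)"
    using neighbours_reach[OF assms(2) S(1)] finite_cell by (intro card_mono) auto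
  finally show ?thesis unfolding spread_def .
qed

lemma spread_mono:
  assumes "spread u i c" "i \<le> j"
  shows "spread u j c"
  using assms(1) card_mono[of "reach E u j \<inter> cell c" "reach E u i \<inter> cell c"] finite_cell
    reach_mono[OF assms(2)] unfolding spread_def by (meson Int_mono finite_Int order_refl order_trans)

text \<open>Decreasing the first index to 0 and then the second leads from any cell to the fixed
  cell \<open>(0, 0)\<close>, where the explorations from two different vertices can meet.\<close>

lemma spread_origin:
  assumes "spread u j (a, b)" "a < m" "b < m"
  shows "spread u (j + a + b) (0, 0)"
proof -
  have "spread u (j + a) (0, b)"
    using assms
  proof (induction a arbitrary: j)
    case (Suc a)
    then have "spread u (Suc j) (a, b)" by (intro spread_step[OF Suc.prems(1)]) auto
    from Suc.IH[OF this] Suc.prems show ?case by simp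
  qed auto
  then show ?thesis
    using assms(3)
  proof (induction b arbitrary: j)
    case (Suc b)
    then have "spread u (Suc j + a) (0, b)" using spread_step[OF Suc.prems(1), of "(0, b)"] by auto
    from Suc.IH[OF this] Suc.prems show ?case by simp
  qed auto
qed

lemma diameter:
  assumes J: "L \<le> g ^ J" and "u < n" "v < n"
  shows "v \<in> reach E u (2 * J + 4 * m + 4)"
proof -
  \<comment> \<open>\<open>Suc J\<close> steps make some cell spread, and fewer than
    \<open>2 * m\<close> steps lead from it to the origin.\<close>
  let ?j = "Suc J + 2 * m"
  have origin: "spread w ?j (0, 0)" if w: "w < n" for w
  proof -
    obtain a b where ab: "a < m" "b < m" "spread w (Suc J) (a, b)"
      using spread_exists[OF w J] by auto
    then show ?thesis using spread_mono[OF spread_origin[OF ab(3,1,2)], of ?j] by simp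
  qed
  \<comment> \<open>The exploration from \<open>u\<close> moves one cell further, so that the two
    sets given to \<open>dense\<close> lie in different cells and are disjoint.\<close>
  have "spread u (Suc ?j) (1, 0)"
    by (rule spread_step[OF origin]) (use m assms in auto)
  then obtain S where S: "S \<subseteq> reach E u (Suc ?j) \<inter> cell (1, 0)" "card S = k"
    unfolding spread_def by (meson obtain_subset_with_card_n)
  obtain U where U: "U \<subseteq> reach E v ?j \<inter> cell (0, 0)" "card U = k"
    using origin[OF assms(3)] unfolding spread_def by (meson obtain_subset_with_card_n)
  have "S \<inter> U = {}" using S U disjoint[of "(1, 0)" "(0, 0)"] by auto
  then have "\<not> no_edge B S U"
    using S U cell_subset[of "(1, 0)"] cell_subset[of "(0, 0)"] by (intro dense) auto
  then obtain x y where xy: "x \<in> S" "y \<in> U" "B {x, y}" by (auto simp: no_edge_def)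
  then have "(x, y) \<in> E" using S U edge[of "(1, 0)" "(0, 0)" x y] by auto
  then have "y \<in> reach E u (Suc (Suc ?j))" using S xy by (auto intro: reach_Suc)
  moreover have "v \<in> reach E y ?j" using U xy by (auto intro: reach_sym[OF sym])
  ultimately have "v \<in> reach E u (Suc (Suc ?j) + ?j)" by (rule reach_trans)
  moreover have "Suc (Suc ?j) + ?j = 2 * J + 4 * m + 4" by simp
  ultimately show ?thesis by metis
qed

end

text \<open>The cells are deterministic here, since the points are already fixed. Each of the two
  properties fails with probability at most \<open>9 / n\<close>, by the weighted union bound and
  \<open>m\<^sup>2 \<le> n\<close>.\<close>

lemma expansion_failure_small:
  fixes cell :: "nat \<times> nat \<Rightarrow> nat set"
  assumes n: "n \<ge> 3" and p: "0 < p" "p \<le> 1" and m: "m\<^sup>2 \<le> n"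
    and cell: "\<And>c. cell c \<subseteq> {..<n}" "\<And>c. c \<in> {..<m} \<times> {..<m} \<Longrightarrow> M \<le> real (card (cell c))"
    and M: "12 * ln (real n) \<le> M * p" and k: "4 * ln (real n) \<le> p * real k"
    and L: "L = ln (real n) / p" and g: "g = M * p / (4 * ln (real n))"
  shows "\<exists>N\<in>sets (bit_space n p). measure (bit_space n p) N \<le> 18 / real n \<and>
    (\<forall>B\<in>space (bit_space n p) - N.
      (\<forall>c S T. c \<in> {..<m} \<times> {..<m} \<longrightarrow> S \<subseteq> {..<n} - cell c \<longrightarrow> T \<subseteq> cell c \<longrightarrow> S \<noteq> {} \<longrightarrow>
        real (card S) \<le> 2 * L \<longrightarrow> real (card T) \<le> g * real (card S) \<longrightarrow> \<not> no_edge B S (cell c - T)) \<and>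
      (\<forall>S U. S \<subseteq> {..<n} \<longrightarrow> U \<subseteq> {..<n} \<longrightarrow> S \<inter> U = {} \<longrightarrow> card S = k \<longrightarrow> card U = k \<longrightarrow>
        \<not> no_edge B S U))"
proof -
  interpret prob_space "bit_space n p" by (rule prob_space_bit_space)
  have n1: "n \<ge> 1" and p': "0 \<le> p" "p \<le> 1" using n p by auto
  have ln: "0 < ln (real n)" using n by simp
  define I where "I = {(c, S, T). c \<in> {..<m} \<times> {..<m} \<and> S \<subseteq> {..<n} - cell c \<and> T \<subseteq> cell c \<and> S \<noteq> {} \<and>
        real (card S) \<le> 2 * L \<and> real (card T) \<le> g * real (card S)}"
  \<comment> \<open>The second property involves no cell; the dummy index \<open>(0, 0)\<close> lets
    the same union bound apply, with \<open>T\<close> itself as the target set.\<close>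
  define I' where "I' = {(c :: nat \<times> nat, S, T). c = (0, 0) \<and> S \<subseteq> {..<n} \<and> T \<subseteq> {..<n} \<and> S \<inter> T = {} \<and>
        card S = k \<and> card T = k}"
  let ?N = "\<Union>(c, S, T)\<in>I. {B \<in> space (bit_space n p). no_edge B S (cell c - T)}"
  let ?N' = "\<Union>(c, S, T)\<in>I'. {B \<in> space (bit_space n p). no_edge B S T}"
  have bd: "(real (card S) + real (card T) + 2) * ln (real n)
      \<le> p * real (card S) * real (card (cell c - T))" if i: "(c, S, T) \<in> I" for c S T
  proof -
    have "finite S" using i finite_subset[of S "{..<n}"] by (auto simp: I_def)
    then have s: "1 \<le> real (card S)" using i by (auto simp: I_def Suc_le_eq card_gt_0_iff)
    have t: "real (card T) \<le> g * real (card S)" and "T \<subseteq> cell c" using i by (auto simp: I_def)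
    have g0: "0 \<le> g" using ln M p by (auto simp: g intro!: divide_nonneg_pos)
    \<comment> \<open>The value of \<open>g\<close> is chosen so that
      \<open>g * (2 * L) = M / 2\<close>: the set \<open>T\<close> takes up at most
      \<open>M / 2\<close> vertices and leaves at least \<open>M / 2\<close> in the cell.\<close>
    have "g * real (card S) \<le> g * (2 * L)" using i g0 by (intro mult_left_mono) (auto simp: I_def)
    also have "\<dots> = M / 2" using ln p by (simp add: g L)
    finally have t2: "real (card T) \<le> M / 2" using t by linarith
    have fin: "finite (cell c)" using cell(1)[of c] finite_subset by blast
    then have "finite T" using \<open>T \<subseteq> cell c\<close> finite_subset by blast
    then have "card (cell c - T) = card (cell c) - card T"
      using \<open>T \<subseteq> cell c\<close> by (rule card_Diff_subset)
    moreover have "card T \<le> card (cell c)" using fin \<open>T \<subseteq> cell c\<close> by (rule card_mono)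
    ultimately have "real (card (cell c - T)) = real (card (cell c)) - real (card T)" by simp
    then have U: "M / 2 \<le> real (card (cell c - T))" using cell(2)[of c] i t2 by (auto simp: I_def)
    \<comment> \<open>As \<open>S\<close> is nonempty, \<open>card S + 2 \<le> 3 * card S\<close>.
      The terms \<open>3 * ln n\<close> and \<open>g * ln n\<close> are then each at most
      \<open>M * p / 4\<close>, the first by the hypothesis on \<open>M\<close> and the second by
      the definition of \<open>g\<close>.\<close>
    have "(real (card S) + real (card T) + 2) * ln (real n)
        \<le> (3 * real (card S) + g * real (card S)) * ln (real n)"
      using s t ln by (intro mult_right_mono) auto
    also have "\<dots> = real (card S) * (3 * ln (real n) + M * p / 4)"
      using ln by (simp add: g field_simps)
    also have "\<dots> \<le> real (card S) * (M * p / 2)"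
      using M by (intro mult_left_mono) auto
    also have "\<dots> = p * real (card S) * (M / 2)" by simp
    also have "\<dots> \<le> p * real (card S) * real (card (cell c - T))"
      using p U by (intro mult_left_mono) auto
    finally show ?thesis .
  qed
  have bd': "(real (card S) + real (card T) + 2) * ln (real n)
      \<le> p * real (card S) * real (card T)" if i: "(c, S, T) \<in> I'" for c S T
  proof -
    have "k \<noteq> 0" using k ln by (intro notI) auto
    \<comment> \<open>Since \<open>1 \<le> k\<close>, \<open>2 * k + 2 \<le> 4 * k\<close>; this is
      the source of the 4 in the hypothesis on \<open>k\<close>.\<close>
    then have "(real k + real k + 2) * ln (real n) \<le> real k * (4 * ln (real n))"
      using ln by (simp add: algebra_simps)
    also have "\<dots> \<le> real k * (p * real k)" using k by (intro mult_left_mono) auto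
    finally show ?thesis using i by (simp add: I'_def mult_ac)
  qed
  have fin: "finite ({..<m} \<times> {..<m})" and fin': "finite {(0 :: nat, 0 :: nat)}" by auto
  have I: "I \<subseteq> ({..<m} \<times> {..<m}) \<times> Pow {..<n} \<times> Pow {..<n}"
    using cell(1) unfolding I_def by blast
  have U: "cell c - T \<subseteq> {..<n} \<and> S \<inter> (cell c - T) = {}" if "(c, S, T) \<in> I" for c S T
    using that cell(1)[of c] unfolding I_def by blast
  note N = measure_UN_no_edge_le[OF n1 p' fin I, of "\<lambda>c T. cell c - T", OF U bd]
  have I': "I' \<subseteq> {(0, 0)} \<times> Pow {..<n} \<times> Pow {..<n}"
    unfolding I'_def by blast
  have U': "T \<subseteq> {..<n} \<and> S \<inter> T = {}" if "(c, S, T) \<in> I'" for c S T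
    using that unfolding I'_def by blast
  have N': "?N' \<in> sets (bit_space n p)"
    by (rule measure_UN_no_edge_le(1)[where U = "\<lambda>_ T. T", OF n1 p' fin' I']; (erule U' | erule bd'))
  have "prob ?N' \<le> 9 * real (card {(0 :: nat, 0 :: nat)}) / (real n)\<^sup>2"
    by (rule measure_UN_no_edge_le(2)[where U = "\<lambda>_ T. T", OF n1 p' fin' I']; (erule U' | erule bd'))
  note N' = N' this
  have "prob (?N \<union> ?N') \<le> prob ?N + prob ?N'"
    using N(1) N'(1) by (rule measure_Un_le)
  also have "\<dots> \<le> 9 * real (m\<^sup>2) / (real n)\<^sup>2 + 9 * 1 / (real n)\<^sup>2"
    using add_mono[OF N(2) N'(2)] by (simp add: card_cartesian_product power2_eq_square)
  also have "\<dots> \<le> 9 * real n / (real n)\<^sup>2 + 9 * real n / (real n)\<^sup>2"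
    using m n by (intro add_mono divide_right_mono mult_left_mono) auto
  also have "\<dots> = 18 / real n" using n by (simp add: power2_eq_square)
  finally have prob: "prob (?N \<union> ?N') \<le> 18 / real n" .
  show ?thesis
  proof (intro bexI[of _ "?N \<union> ?N'"] conjI ballI allI impI prob)
    fix B c S T
    assume B: "B \<in> space (bit_space n p) - (?N \<union> ?N')" and "c \<in> {..<m} \<times> {..<m}" "S \<subseteq> {..<n} - cell c"
      "T \<subseteq> cell c" "S \<noteq> {}" "real (card S) \<le> 2 * L" "real (card T) \<le> g * real (card S)"
    then have "(c, S, T) \<in> I" unfolding I_def by blast
    then show "\<not> no_edge B S (cell c - T)" using B by blast
  next
    fix B S U
    assume B: "B \<in> space (bit_space n p) - (?N \<union> ?N')" and "S \<subseteq> {..<n}" "U \<subseteq> {..<n}" "S \<inter> U = {}"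
      "card S = k" "card U = k"
    then have "((0, 0), S, U) \<in> I'" unfolding I'_def by blast
    then show "\<not> no_edge B S U" using B by blast
  next
    show "?N \<union> ?N' \<in> sets (bit_space n p)" using N(1) N'(1) by (rule sets.Un)
  qed
qed

section \<open>Uniform points in the unit square\<close>

text \<open>Chernoff's method with base 2. Let \<open>q\<close> be the measure of \<open>A\<close>.
  The function \<open>f\<close> is 1/2 on \<open>A\<close> and 1 elsewhere, so the product of the
  \<open>f (x i)\<close> is 2 to the power minus the count; by independence its mean is
  \<open>(1 - q / 2) ^ card I \<le> exp (- q * card I / 2)\<close>. Markov's inequality at the count
  \<open>a = q * card I / 4\<close> costs a factor \<open>2 powr a \<le> exp a\<close>.\<close>

lemma (in prob_space) binomial_lower_tail:
  assumes A: "A \<in> sets M" and I: "finite I"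
  shows "measure (PiM I (\<lambda>_. M)) {x \<in> space (PiM I (\<lambda>_. M)).
      real (card {i \<in> I. x i \<in> A}) \<le> measure M A * real (card I) / 4} \<le> exp (- measure M A * real (card I) / 4)"
proof -
  define q where "q = measure M A"
  have q: "0 \<le> q" "q \<le> 1" by (auto simp: q_def)
  define f :: "'a \<Rightarrow> ennreal" where "f x = ennreal (1 / 2) * indicator A x + indicator (space M - A) x" for x
  have [measurable]: "f \<in> borel_measurable M" using A unfolding f_def by measurable
  define a where "a = q * real (card I) / 4"
  let ?P = "PiM I (\<lambda>_. M)"
  have "(\<integral>\<^sup>+x. f x \<partial>M) = ennreal (1 / 2) * emeasure M A + emeasure M (space M - A)"
    using A unfolding f_def by (subst nn_integral_add) (auto simp: nn_integral_cmult)
  also have "\<dots> = ennreal (1 - q / 2)"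
  proof -
    have "emeasure M (space M - A) = ennreal (1 - q)"
      using A by (simp add: emeasure_eq_measure prob_compl q_def)
    moreover have "emeasure M A = ennreal q" by (simp add: emeasure_eq_measure q_def)
    moreover have "ennreal (1 / 2) * ennreal q = ennreal (1 / 2 * q)"
      by (rule ennreal_mult[symmetric]) (use q in auto)
    moreover have "ennreal (1 / 2 * q) + ennreal (1 - q) = ennreal (1 / 2 * q + (1 - q))"
      by (rule ennreal_plus[symmetric]) (use q in auto)
    ultimately show ?thesis by simp
  qed
  finally have int: "(\<integral>\<^sup>+x. f x \<partial>M) = ennreal (1 - q / 2)" .
  interpret product_prob_space "\<lambda>_. M" I by standard
  have "(\<integral>\<^sup>+x. (\<Prod>i\<in>I. f (x i)) \<partial>?P) = ennreal (1 - q / 2) ^ card I"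
    by (subst product_nn_integral_prod) (auto simp: I int)
  also have "\<dots> = ennreal ((1 - q / 2) ^ card I)" using q by (simp add: ennreal_power)
  also have "\<dots> \<le> ennreal (exp (- q / 2) ^ card I)"
    using exp_ge_add_one_self[of "- q / 2"] q by (intro ennreal_leI power_mono) auto
  also have "exp (- q / 2) ^ card I = exp (- q * real (card I) / 2)"
    by (simp flip: exp_of_nat_mult)
  finally have int_prod: "(\<integral>\<^sup>+x. (\<Prod>i\<in>I. f (x i)) \<partial>?P) \<le> ennreal (exp (- q * real (card I) / 2))" .
  have sub: "{x \<in> space ?P. real (card {i \<in> I. x i \<in> A}) \<le> a} \<subseteq>
      {x \<in> space ?P. 1 \<le> ennreal (2 powr a) * (\<Prod>i\<in>I. f (x i))}"
  proof safe
    fix x assume x: "x \<in> space ?P" "real (card {i \<in> I. x i \<in> A}) \<le> a"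
    have "(\<Prod>i\<in>I. f (x i)) = (\<Prod>i\<in>I. if x i \<in> A then ennreal (1 / 2) else 1)"
      using x by (intro prod.cong) (auto simp: f_def space_PiM indicator_def)
    also have "\<dots> = ennreal (1 / 2) ^ card {i \<in> I. x i \<in> A}"
      using I by (subst prod.If_cases) (simp_all add: Int_def)
    also have "\<dots> = ennreal ((1 / 2) ^ card {i \<in> I. x i \<in> A})" by (rule ennreal_power) simp
    also have "(1 / 2 :: real) ^ l = 2 powr - real l" for l
      by (simp add: powr_minus powr_realpow power_one_over inverse_eq_divide)
    finally have eq: "(\<Prod>i\<in>I. f (x i)) = ennreal (2 powr - real (card {i \<in> I. x i \<in> A}))" .
    have "1 \<le> 2 powr (a - real (card {i \<in> I. x i \<in> A}))" using x(2) by (intro ge_one_powr_ge_zero) auto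
    then show "1 \<le> ennreal (2 powr a) * (\<Prod>i\<in>I. f (x i))"
      unfolding eq by (simp flip: ennreal_mult' powr_add)
  qed
  have "emeasure ?P {x \<in> space ?P. real (card {i \<in> I. x i \<in> A}) \<le> a} \<le>
      emeasure ?P {x \<in> space ?P. 1 \<le> ennreal (2 powr a) * (\<Prod>i\<in>I. f (x i))}"
    by (intro emeasure_mono sub) measurable
  also have "\<dots> \<le> ennreal (2 powr a) * (\<integral>\<^sup>+x. (\<Prod>i\<in>I. f (x i)) * indicator (space ?P) x \<partial>?P)"
    by (intro nn_integral_Markov_inequality) measurable
  also have "(\<integral>\<^sup>+x. (\<Prod>i\<in>I. f (x i)) * indicator (space ?P) x \<partial>?P) = (\<integral>\<^sup>+x. (\<Prod>i\<in>I. f (x i)) \<partial>?P)"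
    by (intro nn_integral_cong) auto
  also have "ennreal (2 powr a) * \<dots> \<le> ennreal (exp a) * ennreal (exp (- q * real (card I) / 2))"
  proof (intro mult_mono int_prod ennreal_leI)
    have "2 powr a = exp (a * ln 2)" by (simp add: powr_def)
    also have "\<dots> \<le> exp a" using q ln_2_less_1 by (auto simp: a_def intro!: mult_left_le)
    finally show "2 powr a \<le> exp a" .
  qed auto
  also have "\<dots> = ennreal (exp (- q * real (card I) / 4))"
    by (simp add: ennreal_mult'[symmetric] exp_add[symmetric] a_def)
  finally have "emeasure ?P {x \<in> space ?P. real (card {i \<in> I. x i \<in> A}) \<le> a} \<le>
    ennreal (exp (- q * real (card I) / 4))" .
  then show ?thesis
    unfolding a_def q_def by (simp add: P.emeasure_eq_measure)
qed

section \<open>The uniform law on the square and its grid boxes\<close>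

abbreviation uniform_point :: "(real \<times> real) measure" where
  "uniform_point \<equiv> uniform_measure lborel unit_square"

abbreviation point_space :: "nat \<Rightarrow> (nat \<Rightarrow> real \<times> real) measure" where
  "point_space n \<equiv> PiM {..<n} (\<lambda>_. uniform_point)"

lemma emeasure_rectangle:
  fixes A B :: "real set"
  assumes "A \<in> sets borel" "B \<in> sets borel"
  shows "emeasure lborel (A \<times> B) = emeasure lborel A * emeasure lborel B"
  using assms by (simp add: lborel_prod[symmetric] lborel.emeasure_pair_measure_Times)

lemma emeasure_unit_square: "emeasure lborel unit_square = 1"
  by (simp add: unit_square_def emeasure_rectangle)

lemma unit_square_borel [measurable]: "unit_square \<in> sets borel"
  unfolding unit_square_def by (intro borel_Times) auto

lemma prob_space_uniform_point: "prob_space uniform_point"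
  by (rule prob_space_uniform_measure) (simp_all add: emeasure_unit_square)

lemma prob_space_point_space: "prob_space (point_space n)"
  by (intro prob_space_PiM prob_space_uniform_point)

lemma emeasure_uniform_point:
  assumes "A \<in> sets borel"
  shows "emeasure uniform_point A = emeasure lborel (unit_square \<inter> A)"
  using assms by (simp add: emeasure_unit_square divide_ennreal_def)

text \<open>Half-open sides make the boxes disjoint; the part of the square that they miss, where a
  coordinate equals 1, is a null set.\<close>

definition grid_box :: "nat \<Rightarrow> nat \<times> nat \<Rightarrow> (real \<times> real) set" where
  "grid_box m c = {real (fst c) / m ..< (real (fst c) + 1) / m} \<times> {real (snd c) / m ..< (real (snd c) + 1) / m}"

lemma grid_box_borel [measurable]: "grid_box m c \<in> sets borel"
  unfolding grid_box_def by (intro borel_Times) auto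

lemma grid_box_subset:
  assumes "c \<in> {..<m} \<times> {..<m}"
  shows "grid_box m c \<subseteq> unit_square"
proof -
  have *: "{real i / m ..< (real i + 1) / m} \<subseteq> {0..1}" if "i < m" for i
  proof -
    have "(real i + 1) / m \<le> 1" "0 \<le> real i / m" using that by (simp_all add: field_simps)
    then show ?thesis by (intro subsetI) (unfold atLeastAtMost_iff atLeastLessThan_iff, intro conjI; linarith)
  qed
  obtain i j where c: "c = (i, j)" "i < m" "j < m" using assms by auto
  show ?thesis
    unfolding grid_box_def unit_square_def c fst_conv snd_conv
    by (rule Sigma_mono[OF *[OF c(2)] *[OF c(3)]])
qed

lemma measure_grid_box:
  assumes "c \<in> {..<m} \<times> {..<m}"
  shows "measure uniform_point (grid_box m c) = 1 / (real m)\<^sup>2"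
proof -
  have m: "m > 0" using assms by auto
  have "emeasure uniform_point (grid_box m c) = emeasure lborel (grid_box m c)"
    using grid_box_subset[OF assms] by (subst emeasure_uniform_point) (auto simp: Int_absorb1)
  also have "\<dots> = ennreal (1 / (real m)\<^sup>2)"
  proof -
    have len: "emeasure lborel {real i / m ..< (real i + 1) / m} = ennreal (1 / m)" for i :: nat
      by (subst emeasure_lborel_Ico) (auto simp: diff_divide_distrib[symmetric] divide_right_mono)
    show ?thesis
      unfolding grid_box_def by (simp add: emeasure_rectangle len ennreal_mult'[symmetric] power2_eq_square)
  qed
  finally show ?thesis by (simp add: measure_def)
qed

lemma grid_box_disjoint:
  assumes "c \<noteq> d"
  shows "grid_box m c \<inter> grid_box m d = {}"
proof -
  have "i = j" if "real i / m \<le> x" "x < (real i + 1) / m" "real j / m \<le> x" "x < (real j + 1) / m"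
    for i j :: nat and x :: real
  proof -
    have "m > 0" using that by (cases "m = 0") auto
    then show ?thesis using that by (simp add: field_simps)
  qed
  then show ?thesis using assms by (cases c; cases d) (auto simp: grid_box_def)
qed

lemma grid_box_cover:
  assumes "x \<in> {0..<1} \<times> {0..<1}" "m > 0"
  shows "\<exists>c\<in>{..<m} \<times> {..<m}. x \<in> grid_box m c"
proof -
  have *: "\<exists>i<m. real i / m \<le> t \<and> t < (real i + 1) / m" if "0 \<le> t" "t < 1" for t :: real
  proof (intro exI[of _ "nat \<lfloor>t * m\<rfloor>"] conjI)
    have "t * m < m" using that assms by simp
    then show "nat \<lfloor>t * m\<rfloor> < m" using that by (simp add: floor_less_iff nat_less_iff)
    have "real (nat \<lfloor>t * m\<rfloor>) \<le> t * m" using that by simp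
    then show "real (nat \<lfloor>t * m\<rfloor>) / m \<le> t" using assms by (simp add: field_simps)
    have "t * m < real (nat \<lfloor>t * m\<rfloor>) + 1" using that by linarith
    then show "t < (real (nat \<lfloor>t * m\<rfloor>) + 1) / m" using assms by (simp add: field_simps)
  qed
  obtain i j where "i < m" "j < m" "real i / m \<le> fst x \<and> fst x < (real i + 1) / m"
    "real j / m \<le> snd x \<and> snd x < (real j + 1) / m"
    using *[of "fst x"] *[of "snd x"] assms by auto
  then show ?thesis by (intro bexI[of _ "(i, j)"]) (auto simp: grid_box_def mem_Times_iff)
qed

definition cell_of :: "nat \<Rightarrow> nat \<Rightarrow> (nat \<Rightarrow> real \<times> real) \<Rightarrow> nat \<times> nat \<Rightarrow> nat set" where
  "cell_of n m X c = {u \<in> {..<n}. X u \<in> grid_box m c}"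

lemma circle_dist_le: "\<bar>circle_dist s t\<bar> \<le> \<bar>s - t\<bar>"
  unfolding circle_dist_def by linarith

text \<open>Each coordinate differs by at most \<open>2 / m\<close>, and the square root of 8 is at
  most 3. Hence boxes of side \<open>1 / m\<close> with \<open>m \<ge> 3 / r\<close>
  suffice.\<close>

lemma torus_dist_adjacent_boxes:
  assumes "grid_adj c d" "x \<in> grid_box m c" "y \<in> grid_box m d" "m > 0"
  shows "torus_dist x y \<le> 3 / real m"
proof -
  have *: "(circle_dist s t)\<^sup>2 \<le> (2 / m)\<^sup>2"
    if "real i / m \<le> s" "s < (real i + 1) / m" "real j / m \<le> t" "t < (real j + 1) / m"
      "i = j \<or> i = Suc j \<or> j = Suc i" for i j :: nat and s t :: real
  proof -
    have "\<bar>s - t\<bar> \<le> 2 / m"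
      using that assms(4) by (auto simp: abs_le_iff field_simps)
    then have "\<bar>circle_dist s t\<bar> \<le> \<bar>2 / m\<bar>" using circle_dist_le[of s t] by linarith
    then show ?thesis by (simp only: abs_le_square_iff)
  qed
  obtain i j i' j' where c: "c = (i, j)" "d = (i', j')" by (cases c; cases d)
  have "(circle_dist (fst x) (fst y))\<^sup>2 \<le> (2 / m)\<^sup>2"
    by (rule *[of i _ i']) (use assms c in \<open>auto simp: grid_box_def\<close>)
  moreover have "(circle_dist (snd x) (snd y))\<^sup>2 \<le> (2 / m)\<^sup>2"
    by (rule *[of j _ j']) (use assms c in \<open>auto simp: grid_box_def\<close>)
  ultimately have "(circle_dist (fst x) (fst y))\<^sup>2 + (circle_dist (snd x) (snd y))\<^sup>2 \<le> 8 / (real m)\<^sup>2"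
    by (simp add: power_divide)
  also have "\<dots> \<le> (3 / real m)\<^sup>2" by (simp add: power_divide divide_right_mono)
  finally show ?thesis unfolding torus_dist_def by (intro real_le_lsqrt) auto
qed

section \<open>The upper bound for a fixed set of points\<close>

lemma grp_graph_arc_iff:
  "(u, v) \<in> parcs (grp_graph n r (X, B)) \<longleftrightarrow>
     u < n \<and> v < n \<and> u \<noteq> v \<and> torus_dist (X u) (X v) \<le> r \<and> B {u, v}"
  by (auto simp: grp_graph_def geometric_graph_def erdos_renyi_graph_def vertex_pairs_def card_2_iff doubleton_eq_iff)

lemma wf_digraph_grp_graph: "wf_digraph (with_proj (grp_graph n r \<omega>))"
proof -
  interpret pair_graph "grp_graph n r \<omega>" by (rule pair_graph_grp_graph)
  show ?thesis by unfold_locales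
qed

lemma sym_grp_graph: "sym (parcs (grp_graph n r \<omega>))"
proof -
  have "torus_dist x y = torus_dist y x" for x y
    by (simp add: torus_dist_def circle_dist_def abs_minus_commute)
  then show ?thesis
    by (cases \<omega>) (auto simp: sym_def grp_graph_arc_iff insert_commute)
qed

text \<open>The points \<open>X\<close> are fixed and only the bits are random, so the exceptional
  set \<open>N\<close> depends on \<open>X\<close>. Outside it the graph satisfies the assumptions
  of \<open>expanding_cells\<close>.\<close>

lemma graph_diam_upper:
  assumes n: "n \<ge> 3" and p: "0 < p" "p \<le> 1" and r: "0 < r" and m: "3 / r \<le> real m" "2 \<le> m" "m\<^sup>2 \<le> n"
    and X: "\<And>u. u < n \<Longrightarrow> X u \<in> {0..<1} \<times> {0..<1}"
    and cells: "\<And>c. c \<in> {..<m} \<times> {..<m} \<Longrightarrow> M \<le> real (card (cell_of n m X c))"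
    and M: "12 * ln (real n) \<le> M * p" and k: "4 * ln (real n) \<le> p * real k" "4 * real k \<le> M"
    and J: "ln (real n) / p \<le> (M * p / (4 * ln (real n))) ^ J"
  shows "\<exists>N\<in>sets (bit_space n p). measure (bit_space n p) N \<le> 18 / real n \<and>
    (\<forall>B\<in>space (bit_space n p) - N.
      graph_diam (with_proj (grp_graph n r (X, B))) \<le> ereal (2 * real J + 4 * real m + 4))"
proof -
  have ln1: "1 \<le> ln (real n)"
    using n exp_le by (subst ln_ge_iff) auto
  define L where "L = ln (real n) / p"
  define g where "g = M * p / (4 * ln (real n))"
  have sub: "cell_of n m X c \<subseteq> {..<n}" for c by (auto simp: cell_of_def)
  define good where "good B \<longleftrightarrow>
      (\<forall>c S T. c \<in> {..<m} \<times> {..<m} \<longrightarrow> S \<subseteq> {..<n} - cell_of n m X c \<longrightarrow> T \<subseteq> cell_of n m X c \<longrightarrow> S \<noteq> {} \<longrightarrow>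
        real (card S) \<le> 2 * L \<longrightarrow> real (card T) \<le> g * real (card S) \<longrightarrow> \<not> no_edge B S (cell_of n m X c - T)) \<and>
      (\<forall>S U. S \<subseteq> {..<n} \<longrightarrow> U \<subseteq> {..<n} \<longrightarrow> S \<inter> U = {} \<longrightarrow> card S = k \<longrightarrow> card U = k \<longrightarrow>
        \<not> no_edge B S U)" for B
  have "\<exists>N\<in>sets (bit_space n p). measure (bit_space n p) N \<le> 18 / real n \<and>
      (\<forall>B\<in>space (bit_space n p) - N. good B)"
    unfolding good_def by (rule expansion_failure_small[OF n p m(3) sub cells M k(1) L_def g_def])
  then obtain N where N: "N \<in> sets (bit_space n p)" "measure (bit_space n p) N \<le> 18 / real n"
    and good: "\<And>B. B \<in> space (bit_space n p) - N \<Longrightarrow> good B"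
    by blast
  have "graph_diam (with_proj (grp_graph n r (X, B))) \<le> ereal (2 * real J + 4 * real m + 4)"
    if B: "B \<in> space (bit_space n p) - N" for B
  proof -
    note good1 = good[OF B, unfolded good_def, THEN conjunct1, rule_format]
    note good2 = good[OF B, unfolded good_def, THEN conjunct2, rule_format]
    have disj: "cell_of n m X c \<inter> cell_of n m X d = {}" if "c \<noteq> d" for c d
      using grid_box_disjoint[OF that, of m] by (auto simp: cell_of_def)
    interpret expanding_cells n m k "parcs (grp_graph n r (X, B))" B "cell_of n m X" g L
    proof
      fix c d u v
      assume cd: "grid_adj c d" and uv: "u \<in> cell_of n m X c" "v \<in> cell_of n m X d" and "B {u, v}"
      have "torus_dist (X u) (X v) \<le> 3 / real m"
        using cd uv m by (intro torus_dist_adjacent_boxes[OF cd]) (auto simp: cell_of_def)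
      also have "\<dots> \<le> r" using m r by (simp add: field_simps)
      finally show "(u, v) \<in> parcs (grp_graph n r (X, B))"
        using uv \<open>B {u, v}\<close> disj[OF grid_adj_neq[OF cd]]
        by (auto simp: grp_graph_arc_iff cell_of_def)
    next
      fix u assume "u < n"
      then show "\<exists>c\<in>{..<m} \<times> {..<m}. u \<in> cell_of n m X c"
        using grid_box_cover[OF X, of u m] m by (auto simp: cell_of_def)
    next
      fix c assume "c \<in> {..<m} \<times> {..<m}"
      then show "2 * k \<le> card (cell_of n m X c)"
        using cells[of c] k by linarith
    next
      show "1 \<le> g" using ln1 M by (simp add: g_def)
      show "1 \<le> L" using ln1 p by (simp add: L_def field_simps)
      \<comment> \<open>The factors \<open>p\<close> and \<open>ln n\<close> cancel, so the locale's
        condition on \<open>k\<close> becomes \<open>4 * k \<le> M\<close>.\<close>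
      have "g * L = M / 4" using ln1 p by (simp add: g_def L_def)
      then show "real k \<le> g * L" using k by simp
    qed (fact good1 good2 sub disj m sym_grp_graph)+
    have "L \<le> g ^ J" using J by (simp add: L_def g_def)
    show ?thesis
    proof (rule graph_diam_le[OF wf_digraph_grp_graph])
      fix u v assume "u \<in> pverts (grp_graph n r (X, B))" "v \<in> pverts (grp_graph n r (X, B))"
      then have "v \<in> reach (parcs (grp_graph n r (X, B))) u (2 * J + 4 * m + 4)"
        by (intro diameter \<open>L \<le> g ^ J\<close>) (auto simp: grp_graph_def)
      then obtain i where "i \<le> 2 * J + 4 * m + 4" "(u, v) \<in> parcs (grp_graph n r (X, B)) ^^ i"
        by (auto simp: reach_def)
      then show "\<exists>i. real i \<le> 2 * real J + 4 * real m + 4 \<and> (u, v) \<in> parcs (grp_graph n r (X, B)) ^^ i"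
        by (intro exI[of _ i]) linarith
    qed
  qed
  then show ?thesis using N by blast
qed

section \<open>Short paths and exceptional events\<close>

lemma torus_dist_measurable:
  "(\<lambda>z. torus_dist (fst z) (snd z)) \<in> borel_measurable (borel \<Otimes>\<^sub>M borel)"
  unfolding torus_dist_def circle_dist_def borel_prod
  by (intro borel_measurable_continuous_onI continuous_intros)

text \<open>Membership in the square is built in because \<open>circle_dist\<close> is the distance
  on the circle only for representatives in the unit interval. For a centre outside the square the
  ball is empty, so the area bound below holds for every centre.\<close>

definition near :: "real \<Rightarrow> real \<times> real \<Rightarrow> real \<times> real \<Rightarrow> bool" where
  "near r x y \<longleftrightarrow> x \<in> unit_square \<and> y \<in> unit_square \<and> torus_dist x y \<le> r"

lemma near_measurable: "Measurable.pred (borel \<Otimes>\<^sub>M borel) (\<lambda>z. near r (fst z) (snd z))"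
proof -
  note torus_dist_measurable [measurable]
  show ?thesis unfolding near_def by measurable
qed

lemma emeasure_circle_ball:
  assumes "z \<in> {0..1}" "0 \<le> r"
  shows "emeasure lborel {t \<in> {0..1}. circle_dist t z \<le> r} \<le> ennreal (4 * r)"
proof -
  \<comment> \<open>The last two intervals are the parts that wrap around 0 and 1; each has length
    at most \<open>r\<close>.\<close>
  have "{t \<in> {0..1}. circle_dist t z \<le> r} \<subseteq> {z - r..z + r} \<union> ({z + 1 - r..1} \<union> {0..z - 1 + r})"
    by (auto simp: circle_dist_def min_le_iff_disj abs_le_iff abs_if split: if_splits)
  then have "emeasure lborel {t \<in> {0..1}. circle_dist t z \<le> r} \<le>
      emeasure lborel ({z - r..z + r} \<union> ({z + 1 - r..1} \<union> {0..z - 1 + r}))"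
    by (intro emeasure_mono) auto
  also have "\<dots> \<le> emeasure lborel {z - r..z + r} + (emeasure lborel {z + 1 - r..1} + emeasure lborel {0..z - 1 + r})"
    by (intro order_trans[OF emeasure_subadditive] add_mono order_refl) auto
  also have "\<dots> \<le> ennreal (2 * r) + (ennreal r + ennreal r)"
    using assms by (intro add_mono) (auto simp: emeasure_lborel_Icc_eq intro!: ennreal_leI)
  also have "\<dots> = ennreal (4 * r)"
    using assms by (simp flip: ennreal_plus)
  finally show ?thesis .
qed

text \<open>The torus distance dominates both coordinate distances, so the ball lies in a product of
  two circle balls, each of length at most \<open>4 * r\<close>.\<close>

lemma emeasure_near_le:
  assumes "0 \<le> r"
  shows "emeasure uniform_point {y. near r y z} \<le> ennreal (16 * r\<^sup>2)"
proof (cases "z \<in> unit_square")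
  case True
  let ?A = "\<lambda>w. {t \<in> {0..1}. circle_dist t w \<le> r}"
  have A: "?A w \<in> sets borel" for w
    unfolding circle_dist_def by measurable
  have "{y. near r y z} \<subseteq> ?A (fst z) \<times> ?A (snd z)"
  proof
    fix y assume "y \<in> {y. near r y z}"
    moreover have "circle_dist (fst y) (fst z) \<le> torus_dist y z" "circle_dist (snd y) (snd z) \<le> torus_dist y z"
      unfolding torus_dist_def by (rule real_sqrt_sum_squares_ge1 real_sqrt_sum_squares_ge2)+
    ultimately show "y \<in> ?A (fst z) \<times> ?A (snd z)"
      by (auto simp: near_def unit_square_def mem_Times_iff)
  qed
  then have "emeasure uniform_point {y. near r y z} \<le> emeasure uniform_point (?A (fst z) \<times> ?A (snd z))"
    using A by (intro emeasure_mono) (auto intro!: borel_Times)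
  also have "\<dots> \<le> emeasure lborel (?A (fst z) \<times> ?A (snd z))"
    using A by (subst emeasure_uniform_point) (auto intro!: borel_Times emeasure_mono)
  also have "\<dots> \<le> ennreal (4 * r) * ennreal (4 * r)"
    unfolding emeasure_rectangle[OF A A]
    by (intro mult_mono emeasure_circle_ball) (use True assms in \<open>auto simp: unit_square_def\<close>)
  also have "\<dots> = ennreal (16 * r\<^sup>2)"
    by (subst ennreal_mult[symmetric]) (use assms in \<open>auto simp: power2_eq_square\<close>)
  finally show ?thesis .
qed (simp add: near_def)

lemma chain_measurable:
  assumes "set vs \<subseteq> I"
  shows "Measurable.pred (PiM I (\<lambda>_. uniform_point)) (\<lambda>X. successively (\<lambda>u v. near r (X u) (X v)) vs)"
  using assms
proof (induction vs rule: induct_list012)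
  case (3 u v ws)
  have [measurable]: "(\<lambda>X. X u) \<in> measurable (PiM I (\<lambda>_. uniform_point)) borel"
    "(\<lambda>X. X v) \<in> measurable (PiM I (\<lambda>_. uniform_point)) borel"
    using 3 measurable_component_singleton[of u I "\<lambda>_. uniform_point"]
      measurable_component_singleton[of v I "\<lambda>_. uniform_point"] by auto
  have [measurable]: "Measurable.pred (PiM I (\<lambda>_. uniform_point)) (\<lambda>X. near r (X u) (X v))"
    using measurable_compose[OF _ near_measurable[of r], of "\<lambda>X. (X u, X v)"] by simp
  have [measurable]: "Measurable.pred (PiM I (\<lambda>_. uniform_point))
      (\<lambda>X. successively (\<lambda>u v. near r (X u) (X v)) (v # ws))"
    by (rule 3(2)) (use 3 in auto)
  show ?case unfolding successively.simps(3) by measurable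
qed simp_all

text \<open>Integrating out the first vertex of the path costs one factor: the area of a ball.\<close>

lemma emeasure_chain_le:
  fixes I :: "'a set"
  assumes "finite I" "distinct (u # vs)" "set (u # vs) \<subseteq> I" "0 \<le> r"
  shows "emeasure (PiM I (\<lambda>_. uniform_point))
      {X \<in> space (PiM I (\<lambda>_. uniform_point)). successively (\<lambda>u v. near r (X u) (X v)) (u # vs)}
    \<le> ennreal (16 * r\<^sup>2) ^ length vs"
  using assms
proof (induction vs arbitrary: u I)
  case Nil
  interpret prob_space "PiM I (\<lambda>_. uniform_point)" by (intro prob_space_PiM prob_space_uniform_point)
  show ?case using emeasure_le_1 by simp
next
  case (Cons v ws)
  interpret uniform_point: prob_space uniform_point by (rule prob_space_uniform_point)
  interpret product_sigma_finite "\<lambda>_ :: 'a. uniform_point" by standard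
  define I' where "I' = I - {u}"
  have I: "I = insert u I'" "u \<notin> I'" "finite I'" "set (v # ws) \<subseteq> I'" using Cons.prems by (auto simp: I'_def)
  let ?P = "\<lambda>I. PiM I (\<lambda>_. uniform_point)"
  let ?C = "\<lambda>vs X. successively (\<lambda>u v. near r (X u) (X v)) vs"
  note [measurable] = chain_measurable[OF Cons.prems(3)] chain_measurable[OF I(4)]
  have "emeasure (?P I) {X \<in> space (?P I). ?C (u # v # ws) X} =
      (\<integral>\<^sup>+X. indicator {X \<in> space (?P I). ?C (u # v # ws) X} X \<partial>?P I)"
    by (intro nn_integral_indicator[symmetric]) measurable
  also have "\<dots> = (\<integral>\<^sup>+X. (\<integral>\<^sup>+y. indicator {X \<in> space (?P I). ?C (u # v # ws) X} (X(u := y)) \<partial>uniform_point) \<partial>?P I')"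
    unfolding I(1) by (intro product_nn_integral_insert I) (unfold I(1)[symmetric], measurable)
  also have "\<dots> \<le> (\<integral>\<^sup>+X. ennreal (16 * r\<^sup>2) * indicator {X \<in> space (?P I'). ?C (v # ws) X} X \<partial>?P I')"
  proof (intro nn_integral_mono)
    fix X assume X: "X \<in> space (?P I')"
    \<comment> \<open>The path has distinct vertices, so the rest of it does not involve the point
      of \<open>u\<close>, and its indicator is a constant factor of the inner integral.\<close>
    have "?C (v # ws) (X(u := y)) = ?C (v # ws) X" for y
      by (rule successively_cong) (use Cons.prems in auto)
    then have "(\<integral>\<^sup>+y. indicator {X \<in> space (?P I). ?C (u # v # ws) X} (X(u := y)) \<partial>uniform_point) \<le>
        (\<integral>\<^sup>+y. indicator {y. near r y (X v)} y * indicator {X \<in> space (?P I'). ?C (v # ws) X} X \<partial>uniform_point)"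
      using X Cons.prems by (intro nn_integral_mono) (auto simp: indicator_def)
    also have "\<dots> = emeasure uniform_point {y. near r y (X v)} * indicator {X \<in> space (?P I'). ?C (v # ws) X} X"
    proof (subst nn_integral_multc)
      have "{y. near r y (X v)} \<in> sets uniform_point"
        using measurable_compose[OF _ near_measurable[of r], of "\<lambda>y. (y, X v)" borel] by (simp add: pred_def)
      then show "indicator {y. near r y (X v)} \<in> borel_measurable uniform_point"
        "(\<integral>\<^sup>+y. indicator {y. near r y (X v)} y \<partial>uniform_point) * indicator {X \<in> space (?P I'). ?C (v # ws) X} X =
         emeasure uniform_point {y. near r y (X v)} * indicator {X \<in> space (?P I'). ?C (v # ws) X} X"
        by auto
    qed
    also have "\<dots> \<le> ennreal (16 * r\<^sup>2) * indicator {X \<in> space (?P I'). ?C (v # ws) X} X"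
      using Cons.prems by (intro mult_right_mono emeasure_near_le) auto
    finally show "(\<integral>\<^sup>+y. indicator {X \<in> space (?P I). ?C (u # v # ws) X} (X(u := y)) \<partial>uniform_point) \<le> \<dots>" .
  qed
  also have "\<dots> = ennreal (16 * r\<^sup>2) * emeasure (?P I') {X \<in> space (?P I'). ?C (v # ws) X}"
    by (subst nn_integral_cmult) (auto intro!: arg_cong2[where f = "(*)"] nn_integral_indicator simp: pred_def)
  also have "\<dots> \<le> ennreal (16 * r\<^sup>2) * ennreal (16 * r\<^sup>2) ^ length ws"
    using Cons.prems I by (intro mult_left_mono Cons.IH) auto
  finally show ?case by simp
qed

section \<open>First-moment bound for short paths\<close>

fun path_edges :: "'a list \<Rightarrow> 'a set set" where
  "path_edges (u # v # ws) = insert {u, v} (path_edges (v # ws))"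
| "path_edges _ = {}"

lemma path_edges_subset: "e \<in> path_edges vs \<Longrightarrow> e \<subseteq> set vs"
  by (induction vs rule: path_edges.induct) auto

lemma finite_path_edges: "finite (path_edges vs)"
  by (induction vs rule: path_edges.induct) auto

lemma card_path_edges: "distinct vs \<Longrightarrow> card (path_edges vs) = length vs - 1"
proof (induction vs rule: path_edges.induct)
  case (1 u v ws)
  then have "{u, v} \<notin> path_edges (v # ws)" using path_edges_subset[of "{u, v}" "v # ws"] by auto
  then show ?case using 1 by (simp add: finite_path_edges)
qed auto

lemma path_edges_vertex_pairs: "distinct vs \<Longrightarrow> set vs \<subseteq> {..<n} \<Longrightarrow> path_edges vs \<subseteq> vertex_pairs n"
  by (induction vs rule: path_edges.induct) (auto simp: vertex_pairs_def)

lemma path_edges_successively: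
  "successively (\<lambda>u v. B {u, v}) vs \<longleftrightarrow> (\<forall>e\<in>path_edges vs. B e)"
  by (induction vs rule: path_edges.induct) auto

text \<open>Fubini's theorem, used to condition on the points: a bound on the bits that is uniform
  in the point set holds for the joint law.\<close>

lemma measure_pair_section_le:
  assumes M: "prob_space M" and N: "prob_space N" and A: "A \<in> sets (M \<Otimes>\<^sub>M N)" and "0 \<le> \<epsilon>"
    and sec: "\<And>x. x \<in> space M \<Longrightarrow> measure N (Pair x -` A) \<le> \<epsilon>"
  shows "measure (M \<Otimes>\<^sub>M N) A \<le> \<epsilon>"
proof -
  interpret M: prob_space M by fact
  interpret N: prob_space N by fact
  interpret P: prob_space "M \<Otimes>\<^sub>M N" using M N by (rule prob_space_pair)
  have "emeasure (M \<Otimes>\<^sub>M N) A = (\<integral>\<^sup>+x. emeasure N (Pair x -` A) \<partial>M)"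
    using A by (rule N.emeasure_pair_measure_alt)
  also have "\<dots> \<le> (\<integral>\<^sup>+x. ennreal \<epsilon> \<partial>M)"
    using sec by (intro nn_integral_mono) (auto simp: N.emeasure_eq_measure intro: ennreal_leI)
  also have "\<dots> = ennreal \<epsilon>" by (simp add: M.emeasure_space_1)
  finally show ?thesis using \<open>0 \<le> \<epsilon>\<close> by (simp add: P.emeasure_eq_measure)
qed

lemma successively_imp_subset:
  "successively (\<lambda>u v. (u, v) \<in> parcs (grp_graph n r \<omega>)) (u # vs) \<Longrightarrow> set vs \<subseteq> {..<n}"
  by (induction vs arbitrary: u) (auto simp: grp_graph_def geometric_graph_def vertex_pairs_def)

text \<open>The event is a rectangle: the condition on the points contributes a ball area for each
  step, the condition on the bits a factor \<open>p\<close> for each of the \<open>length vs\<close>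
  distinct edges.\<close>

lemma path_event:
  assumes "distinct (u # vs)" "set (u # vs) \<subseteq> {..<n}" "0 \<le> r" "0 \<le> p" "p \<le> 1"
  shows "{\<omega> \<in> space (grp_space n p). successively (\<lambda>u v. near r (fst \<omega> u) (fst \<omega> v)) (u # vs) \<and>
      (\<forall>e\<in>path_edges (u # vs). snd \<omega> e)} \<in> sets (grp_space n p)"
    and "measure (grp_space n p) {\<omega> \<in> space (grp_space n p).
      successively (\<lambda>u v. near r (fst \<omega> u) (fst \<omega> v)) (u # vs) \<and>
      (\<forall>e\<in>path_edges (u # vs). snd \<omega> e)} \<le> (16 * r\<^sup>2 * p) ^ length vs"
proof -
  let ?A = "{X \<in> space (point_space n). successively (\<lambda>u v. near r (X u) (X v)) (u # vs)}"
  let ?B = "{B \<in> space (bit_space n p). \<forall>e\<in>path_edges (u # vs). B e = True}"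
  interpret A: prob_space "point_space n" by (rule prob_space_point_space)
  interpret B: prob_space "bit_space n p" by (rule prob_space_bit_space)
  interpret P: prob_space "grp_space n p" by (rule prob_space_grp_space)
  have eq: "{\<omega> \<in> space (grp_space n p). successively (\<lambda>u v. near r (fst \<omega> u) (fst \<omega> v)) (u # vs) \<and>
      (\<forall>e\<in>path_edges (u # vs). snd \<omega> e)} = ?A \<times> ?B"
    by (auto simp: grp_space_def space_pair_measure)
  have A: "?A \<in> sets (point_space n)"
    using chain_measurable[OF assms(2), of r] by (simp add: pred_def)
  have pe: "path_edges (u # vs) \<subseteq> vertex_pairs n"
    using assms by (intro path_edges_vertex_pairs)
  have B: "?B \<in> sets (bit_space n p)" using pe by (rule bit_event_sets)
  show "{\<omega> \<in> space (grp_space n p). successively (\<lambda>u v. near r (fst \<omega> u) (fst \<omega> v)) (u # vs) \<and>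
      (\<forall>e\<in>path_edges (u # vs). snd \<omega> e)} \<in> sets (grp_space n p)"
    unfolding eq unfolding grp_space_def using A B by (rule pair_measureI)
  have "emeasure (grp_space n p) (?A \<times> ?B) = emeasure (point_space n) ?A * emeasure (bit_space n p) ?B"
    unfolding grp_space_def using A B by (rule B.emeasure_pair_measure_Times)
  also have "emeasure (bit_space n p) ?B = ennreal (p ^ length vs)"
    using measure_bit_event[OF pe assms(4,5), of True] card_path_edges[OF assms(1)]
    by (simp add: B.emeasure_eq_measure)
  also have "emeasure (point_space n) ?A * ennreal (p ^ length vs) \<le>
      ennreal (16 * r\<^sup>2) ^ length vs * ennreal (p ^ length vs)"
    using assms by (intro mult_right_mono emeasure_chain_le) auto
  also have "\<dots> = ennreal ((16 * r\<^sup>2 * p) ^ length vs)"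
    using assms by (simp add: ennreal_power ennreal_mult[symmetric] power_mult_distrib)
  finally have "emeasure (grp_space n p) (?A \<times> ?B) \<le> ennreal ((16 * r\<^sup>2 * p) ^ length vs)" .
  then show "measure (grp_space n p) {\<omega> \<in> space (grp_space n p).
      successively (\<lambda>u v. near r (fst \<omega> u) (fst \<omega> v)) (u # vs) \<and>
      (\<forall>e\<in>path_edges (u # vs). snd \<omega> e)} \<le> (16 * r\<^sup>2 * p) ^ length vs"
    unfolding eq using assms by (simp add: P.emeasure_eq_measure)
qed

text \<open>A walk of length at most \<open>h\<close> from 0 to 1 contains a path with some number
  \<open>l < h\<close> of inner vertices. There are at most \<open>n ^ l\<close> choices of these,
  and each path has \<open>Suc l\<close> edges; the bound is the expected number of such paths. The
  vertices 0 and 1 stand for any two given vertices.\<close>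

lemma short_path_unlikely:
  assumes n: "n \<ge> 2" and r: "0 \<le> r" and p: "0 \<le> p" "p \<le> 1"
  shows "\<exists>N\<in>sets (grp_space n p).
    measure (grp_space n p) N \<le> (\<Sum>l<h. real n ^ l * (16 * r\<^sup>2 * p) ^ Suc l) \<and>
    (\<forall>\<omega>\<in>space (grp_space n p) - N. (\<forall>u<n. fst \<omega> u \<in> unit_square) \<longrightarrow>
      (\<forall>i. (0, 1) \<in> parcs (grp_graph n r \<omega>) ^^ i \<longrightarrow> h < i))"
proof -
  interpret prob_space "grp_space n p" by (rule prob_space_grp_space)
  define W where "W l = {ws. set ws \<subseteq> {..<n} \<and> length ws = l \<and> distinct (0 # ws @ [1])}" for l
  let ?A = "\<lambda>ws. {\<omega> \<in> space (grp_space n p). successively (\<lambda>u v. near r (fst \<omega> u) (fst \<omega> v)) (0 # ws @ [1]) \<and>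
      (\<forall>e\<in>path_edges (0 # ws @ [1]). snd \<omega> e)}"
  let ?N = "\<Union>l<h. \<Union>ws\<in>W l. ?A ws"
  have sub: "W l \<subseteq> {ws. set ws \<subseteq> {..<n} \<and> length ws = l}" for l by (auto simp: W_def)
  have fin: "finite (W l)" for l
    using finite_lists_length_eq[of "{..<n}" l] by (intro finite_subset[OF sub]) auto
  have A: "?A ws \<in> events" "prob (?A ws) \<le> (16 * r\<^sup>2 * p) ^ Suc l" if "ws \<in> W l" for ws l
    using path_event[of 0 "ws @ [1]" n r p] that n r p by (auto simp: W_def)
  have Nl: "(\<Union>ws\<in>W l. ?A ws) \<in> events" for l by (rule sets.finite_UN[OF fin]) (rule A(1))
  have N: "?N \<in> events" by (rule sets.finite_UN[OF finite_lessThan]) (rule Nl)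
  have "prob (\<Union>ws\<in>W l. ?A ws) \<le> real n ^ l * (16 * r\<^sup>2 * p) ^ Suc l" for l
  proof -
    have "prob (\<Union>ws\<in>W l. ?A ws) \<le> (\<Sum>ws\<in>W l. prob (?A ws))"
      by (rule finite_measure_subadditive_finite[OF fin]) (use A(1) in blast)
    also have "\<dots> \<le> (\<Sum>ws\<in>W l. (16 * r\<^sup>2 * p) ^ Suc l)" by (intro sum_mono A(2))
    also have "\<dots> = real (card (W l)) * (16 * r\<^sup>2 * p) ^ Suc l" by simp
    also have "\<dots> \<le> real (n ^ l) * (16 * r\<^sup>2 * p) ^ Suc l"
      using card_mono[OF _ sub[of l]] card_lists_length_eq[of "{..<n}" l] finite_lists_length_eq[of "{..<n}" l] p
      by (intro mult_right_mono of_nat_mono) auto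
    finally show ?thesis by simp
  qed
  then have "(\<Sum>l<h. prob (\<Union>ws\<in>W l. ?A ws)) \<le> (\<Sum>l<h. real n ^ l * (16 * r\<^sup>2 * p) ^ Suc l)"
    by (intro sum_mono)
  moreover have "prob ?N \<le> (\<Sum>l<h. prob (\<Union>ws\<in>W l. ?A ws))"
    by (rule finite_measure_subadditive_finite[OF finite_lessThan]) (use Nl in blast)
  ultimately have prob: "prob ?N \<le> (\<Sum>l<h. real n ^ l * (16 * r\<^sup>2 * p) ^ Suc l)" by linarith
  have "h < i" if \<omega>: "\<omega> \<in> space (grp_space n p) - ?N" "\<forall>u<n. fst \<omega> u \<in> unit_square"
    and i: "(0, 1) \<in> parcs (grp_graph n r \<omega>) ^^ i" for \<omega> i
  proof (rule ccontr)
    assume "\<not> h < i"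
    obtain X B where XB: "\<omega> = (X, B)" by (cases \<omega>)
    obtain xs where xs: "distinct (0 # xs)" "length xs \<le> i" "last (0 # xs) = (1 :: nat)"
      "successively (\<lambda>u v. (u, v) \<in> parcs (grp_graph n r \<omega>)) (0 # xs)"
      using relpow_imp_distinct_path[OF i] by blast
    define ws where "ws = butlast xs"
    have "xs \<noteq> []" using xs(3) by auto
    then have ws: "xs = ws @ [1]" using xs(3) append_butlast_last_id[of xs] by (simp add: ws_def)
    have set: "set (0 # xs) \<subseteq> {..<n}" using successively_imp_subset[OF xs(4)] n by auto
    have "ws \<in> W (length ws)" using xs set ws by (auto simp: W_def)
    moreover have "length ws < h" using xs(2) ws \<open>\<not> h < i\<close> by simp
    moreover have "successively (\<lambda>u v. near r (fst \<omega> u) (fst \<omega> v)) (0 # ws @ [1])"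
      by (rule successively_mono[OF xs(4)[unfolded ws]]) (use \<omega>(2) in \<open>auto simp: near_def XB grp_graph_arc_iff\<close>)
    moreover have "successively (\<lambda>u v. snd \<omega> {u, v}) (0 # ws @ [1])"
      using xs(4) unfolding ws by (rule successively_mono) (auto simp: XB grp_graph_arc_iff)
    ultimately have "\<omega> \<in> ?N" using \<omega>(1) unfolding path_edges_successively by blast
    then show False using \<omega>(1) by blast
  qed
  then show ?thesis using N prob by blast
qed

text \<open>A point falls into a given box with probability \<open>q = 1 / (real m)\<^sup>2\<close>,
  so \<open>binomial_lower_tail\<close> bounds the failure of one box, and
  \<open>m\<^sup>2 \<le> n\<close> bounds the number of boxes.\<close>

lemma cells_occupied:
  assumes m: "m \<ge> 1" "m\<^sup>2 \<le> n"
  shows "\<exists>N\<in>sets (point_space n).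
    measure (point_space n) N \<le> real n * exp (- (real n / (4 * (real m)\<^sup>2))) \<and>
    (\<forall>X\<in>space (point_space n) - N. (\<forall>u<n. X u \<in> {0..<1} \<times> {0..<1}) \<and>
      (\<forall>c\<in>{..<m} \<times> {..<m}. real n / (4 * (real m)\<^sup>2) < real (card (cell_of n m X c))))"
proof -
  interpret U: prob_space uniform_point by (rule prob_space_uniform_point)
  interpret product_prob_space "\<lambda>_. uniform_point" "{..<n}" by standard
  interpret P: prob_space "point_space n" by (rule prob_space_point_space)
  \<comment> \<open>The points in no half-open box; this set has probability 0 under the uniform
    law.\<close>
  define S :: "(real \<times> real) set" where "S = - ({0..<1} \<times> {0..<1})"
  define a where "a = real n / (4 * (real m)\<^sup>2)"
  let ?S = "{0..<1} \<times> {0..<1} :: (real \<times> real) set"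
  have S': "?S \<in> sets borel" by (intro borel_Times) auto
  then have S: "S \<in> sets uniform_point" unfolding S_def by auto
  let ?A = "\<lambda>u. {X \<in> space (point_space n). X u \<in> S}"
  let ?B = "\<lambda>c. {X \<in> space (point_space n). real (card (cell_of n m X c)) \<le> a}"
  have "unit_square \<inter> ?S = ?S" by (auto simp: unit_square_def)
  then have "emeasure uniform_point ?S = 1"
    using emeasure_uniform_point[OF S'] by (simp add: emeasure_rectangle)
  then have "U.prob (space uniform_point - ?S) = 0"
    using S' by (subst U.prob_compl) (auto simp: measure_def)
  then have S0: "emeasure uniform_point S = 0"
    by (simp add: U.emeasure_eq_measure Compl_eq_Diff_UNIV S_def)
  have A: "?A u \<in> sets (point_space n)" "P.prob (?A u) \<le> 0" if "u \<in> {..<n}" for u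
  proof -
    have "{y \<in> space uniform_point. y \<in> S} = S" by auto
    with S that show "?A u \<in> sets (point_space n)" by (intro sets_Collect_single') simp_all
    have "emeasure (point_space n) (?A u) = emeasure uniform_point S"
      using that S by (intro emeasure_PiM_Collect_single)
    with S0 have "emeasure (point_space n) (?A u) = 0" by (simp only:)
    then show "P.prob (?A u) \<le> 0" by (simp add: measure_def)
  qed
  have B: "?B c \<in> sets (point_space n)" "P.prob (?B c) \<le> exp (- a)"
    if c: "c \<in> {..<m} \<times> {..<m}" for c
  proof -
    have eq: "real (card (cell_of n m X c)) = (\<Sum>u<n. indicator (grid_box m c) (X u))" for X
      by (simp add: cell_of_def indicator_def sum.If_cases Int_def)
    show "?B c \<in> sets (point_space n)"
      unfolding eq by measurable
    show "P.prob (?B c) \<le> exp (- a)"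
      using U.binomial_lower_tail[of "grid_box m c" "{..<n}"] measure_grid_box[OF c]
      by (simp add: cell_of_def mult.commute a_def)
  qed
  let ?N1 = "\<Union>u<n. ?A u" and ?N2 = "\<Union>c\<in>{..<m} \<times> {..<m}. ?B c"
  have fin: "finite ({..<m} \<times> {..<m})" by simp
  have N1: "?N1 \<in> sets (point_space n)" by (rule sets.finite_UN[OF finite_lessThan]) (rule A(1))
  have N2: "?N2 \<in> sets (point_space n)" by (rule sets.finite_UN[OF fin]) (rule B(1))
  have "P.prob ?N1 \<le> (\<Sum>u<n. P.prob (?A u))"
    by (rule P.finite_measure_subadditive_finite[OF finite_lessThan]) (use A(1) in blast)
  also have "\<dots> \<le> 0" by (intro sum_nonpos A(2))
  finally have 1: "P.prob ?N1 \<le> 0" .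
  have "P.prob ?N2 \<le> (\<Sum>c\<in>{..<m} \<times> {..<m}. P.prob (?B c))"
    by (rule P.finite_measure_subadditive_finite[OF fin]) (use B(1) in blast)
  also have "\<dots> \<le> (\<Sum>c\<in>{..<m} \<times> {..<m}. exp (- a))" by (intro sum_mono B(2))
  also have "\<dots> = real (m\<^sup>2) * exp (- a)"
    by (simp add: card_cartesian_product power2_eq_square)
  also have "\<dots> \<le> real n * exp (- a)"
    using m by (intro mult_right_mono of_nat_mono) auto
  finally have 2: "P.prob ?N2 \<le> real n * exp (- a)" .
  have "P.prob (?N1 \<union> ?N2) \<le> P.prob ?N1 + P.prob ?N2" using N1 N2 by (rule measure_Un_le)
  with 1 2 have prob: "P.prob (?N1 \<union> ?N2) \<le> real n * exp (- a)" by linarith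
  have good: "X u \<in> ?S"
    if "X \<in> space (point_space n) - (?N1 \<union> ?N2)" "u < n" for X u
  proof -
    have "X u \<notin> S" using that by blast
    then show "X u \<in> ?S" unfolding S_def by blast
  qed
  have good2: "a < real (card (cell_of n m X c))"
    if "X \<in> space (point_space n) - (?N1 \<union> ?N2)" "c \<in> {..<m} \<times> {..<m}" for X c
  proof (rule ccontr)
    assume "\<not> a < real (card (cell_of n m X c))"
    then have "X \<in> ?B c" using that(1) by simp
    then show False using that by blast
  qed
  have N: "?N1 \<union> ?N2 \<in> sets (point_space n)" using N1 N2 by (rule sets.Un)
  show ?thesis
    unfolding a_def[symmetric]
  proof (rule bexI[OF _ N], rule conjI[OF prob], rule ballI, rule conjI)
    fix X assume X: "X \<in> space (point_space n) - (?N1 \<union> ?N2)"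
    show "\<forall>u<n. X u \<in> ?S" using good[OF X] by blast
    show "\<forall>c\<in>{..<m} \<times> {..<m}. a < real (card (cell_of n m X c))" using good2[OF X] by blast
  qed
qed

section \<open>The lower bound of order \<open>1 / r\<close>\<close>

lemma circle_dist_triangle:
  assumes "s \<in> {0..1}" "t \<in> {0..1}" "w \<in> {0..1}"
  shows "circle_dist s w \<le> circle_dist s t + circle_dist t w"
proof -
  define a b c where "a = \<bar>s - t\<bar>" and "b = \<bar>t - w\<bar>" and "c = \<bar>s - w\<bar>"
  \<comment> \<open>These four inequalities settle the four ways in which the minima for
    \<open>(s, t)\<close> and \<open>(t, w)\<close> can be attained; the last one covers the case
    where both go around the circle.\<close>
  have "c \<le> a + b" "a \<le> b + c" "b \<le> a + c" "a + b + c \<le> 2"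
    using assms unfolding a_def b_def c_def by (auto simp: abs_if)
  then show ?thesis
    unfolding circle_dist_def a_def[symmetric] b_def[symmetric] c_def[symmetric] by (simp add: min_def)
qed

text \<open>Following the first coordinate alone suffices: an edge changes it by at most the torus
  distance, hence by at most \<open>r\<close>.\<close>

lemma relpow_circle_dist_le:
  assumes X: "\<And>u. u < n \<Longrightarrow> X u \<in> unit_square" and "(u, v) \<in> parcs (grp_graph n r (X, B)) ^^ i" "u < n"
  shows "v < n \<and> circle_dist (fst (X u)) (fst (X v)) \<le> real i * r"
  using assms(2)
proof (induction i arbitrary: v)
  case 0
  then show ?case using assms(3) by (simp add: circle_dist_def)
next
  case (Suc i)
  then obtain w where w: "(u, w) \<in> parcs (grp_graph n r (X, B)) ^^ i" "(w, v) \<in> parcs (grp_graph n r (X, B))"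
    by auto
  then have wv: "w < n" "v < n" "torus_dist (X w) (X v) \<le> r" by (auto simp: grp_graph_arc_iff)
  have "circle_dist (fst (X w)) (fst (X v)) \<le> torus_dist (X w) (X v)"
    unfolding torus_dist_def by (rule real_sqrt_sum_squares_ge1)
  moreover have "circle_dist (fst (X u)) (fst (X v)) \<le>
      circle_dist (fst (X u)) (fst (X w)) + circle_dist (fst (X w)) (fst (X v))"
    using X[of u] X[of v] X[of w] wv assms(3) by (intro circle_dist_triangle) (auto simp: unit_square_def)
  ultimately show ?case using Suc.IH[OF w(1)] wv by (simp add: algebra_simps)
qed

text \<open>Points in the boxes with first indices 0 and \<open>m div 2\<close> have first
  coordinates that differ by at least 1/4 and at most 3/4, so they are far apart in both directions
  around the circle.\<close>

lemma graph_diam_lower_geometric: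
  assumes r: "0 < r" and m: "7 \<le> m" and X: "\<And>u. u < n \<Longrightarrow> X u \<in> unit_square"
    and cells: "\<And>c. c \<in> {..<m} \<times> {..<m} \<Longrightarrow> cell_of n m X c \<noteq> {}"
  shows "ereal (1 / (4 * r)) \<le> graph_diam (with_proj (grp_graph n r (X, B)))"
proof -
  obtain u v where u: "u < n" "X u \<in> grid_box m (0, 0)" and v: "v < n" "X v \<in> grid_box m (m div 2, 0)"
    using cells[of "(0, 0)"] cells[of "(m div 2, 0)"] m by (auto simp: cell_of_def)
  define x y where "x = fst (X u)" and "y = fst (X v)"
  have x: "0 \<le> x" "x * m < 1" using u m by (auto simp: grid_box_def x_def field_simps)
  have y: "real (m div 2) \<le> y * m" "y * m < real (m div 2) + 1" using v m by (auto simp: grid_box_def y_def field_simps)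
  have h: "real m \<le> 2 * real (m div 2) + 1" "2 * real (m div 2) \<le> real m" by linarith+
  have m7: "7 \<le> real m" using m by simp
  \<comment> \<open>The scaled difference exceeds \<open>m div 2 - 1\<close>, which is at least
    \<open>(m - 3) / 2\<close> and so at least \<open>m / 4\<close> for
    \<open>m \<ge> 7\<close>.\<close>
  have "(1 / 4) * m \<le> (y - x) * m"
    unfolding left_diff_distrib using x y h m7 by linarith
  then have 1: "1 / 4 \<le> y - x" by (rule mult_right_le_imp_le) (use m7 in simp)
  have "(y - x) * m \<le> (3 / 4) * m"
    unfolding left_diff_distrib using x y h m7 mult_nonneg_nonneg[of x "real m"] by linarith
  then have 2: "y - x \<le> 3 / 4" by (rule mult_right_le_imp_le) (use m7 in simp)
  have far: "1 / 4 \<le> circle_dist x y" using 1 2 by (auto simp: circle_dist_def)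
  show ?thesis
  proof (rule graph_diam_ge[OF wf_digraph_grp_graph, of u _ _ _ v])
    fix i assume "(u, v) \<in> parcs (grp_graph n r (X, B)) ^^ i"
    from relpow_circle_dist_le[OF X this u(1)] far have "1 / 4 \<le> real i * r" by (simp add: x_def y_def)
    then show "1 / (4 * r) \<le> real i" using r by (simp add: field_simps)
  qed (use u v in \<open>auto simp: grp_graph_def\<close>)
qed

section \<open>Measurability of graph events\<close>

lemma arc_event_sets:
  "{\<omega> \<in> space (grp_space n p). (u, v) \<in> parcs (grp_graph n r \<omega>)} \<in> sets (grp_space n p)"
proof (cases "u < n \<and> v < n \<and> u \<noteq> v")
  case True
  let ?A = "{X \<in> space (point_space n). torus_dist (X u) (X v) \<le> r}"
  let ?B = "{B \<in> space (bit_space n p). \<forall>e\<in>{{u, v}}. B e = True}"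
  have [measurable]: "(\<lambda>X. X u) \<in> measurable (point_space n) borel" "(\<lambda>X. X v) \<in> measurable (point_space n) borel"
    using True measurable_component_singleton[of u "{..<n}" "\<lambda>_. uniform_point"]
      measurable_component_singleton[of v "{..<n}" "\<lambda>_. uniform_point"] by auto
  have [measurable]: "(\<lambda>X. torus_dist (X u) (X v)) \<in> borel_measurable (point_space n)"
    using measurable_compose[OF _ torus_dist_measurable, of "\<lambda>X. (X u, X v)"] by simp
  have "?A \<in> sets (point_space n)" by measurable
  moreover have "?B \<in> sets (bit_space n p)"
    using True by (intro bit_event_sets) (auto simp: vertex_pairs_def)
  ultimately have "?A \<times> ?B \<in> sets (grp_space n p)" unfolding grp_space_def by (rule pair_measureI)
  also have "?A \<times> ?B = {\<omega> \<in> space (grp_space n p). (u, v) \<in> parcs (grp_graph n r \<omega>)}"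
    using True by (auto simp: grp_space_def space_pair_measure grp_graph_arc_iff)
  finally show ?thesis .
next
  case False
  then have "{\<omega> \<in> space (grp_space n p). (u, v) \<in> parcs (grp_graph n r \<omega>)} = {}"
    by (auto simp: grp_graph_def geometric_graph_def vertex_pairs_def card_2_iff doubleton_eq_iff)
  then show ?thesis by (simp only: sets.empty_sets)
qed

text \<open>Only finitely many arc sets are possible, and prescribing the arc set is a finite
  conjunction of arc events and their complements. Hence an arbitrary predicate \<open>Q\<close>
  defines an event, and in particular the diameter is measurable.\<close>

lemma graph_event_sets: "{\<omega> \<in> space (grp_space n p). Q (grp_graph n r \<omega>)} \<in> sets (grp_space n p)"
proof -
  let ?V = "{..<n} \<times> {..<n}"
  let ?E = "\<lambda>A. {\<omega> \<in> space (grp_space n p). parcs (grp_graph n r \<omega>) = A}"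
  have sub: "parcs (grp_graph n r \<omega>) \<subseteq> ?V" for \<omega>
    by (auto simp: grp_graph_def geometric_graph_def vertex_pairs_def)
  have "?E A \<in> sets (grp_space n p)" if "A \<subseteq> ?V" for A
  proof -
    have "{\<omega> \<in> space (grp_space n p). \<forall>e\<in>?V. e \<in> parcs (grp_graph n r \<omega>) \<longleftrightarrow> e \<in> A} \<in> sets (grp_space n p)"
    proof (intro sets.sets_Collect_finite_All)
      fix e :: "nat \<times> nat"
      obtain u v where e: "e = (u, v)" by (cases e)
      show "{\<omega> \<in> space (grp_space n p). e \<in> parcs (grp_graph n r \<omega>) \<longleftrightarrow> e \<in> A} \<in> sets (grp_space n p)"
        using arc_event_sets[of n p u v r] sets.sets_Collect_neg[OF arc_event_sets[of n p u v r]]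
        by (cases "e \<in> A") (auto simp: e)
    qed auto
    also have "{\<omega> \<in> space (grp_space n p). \<forall>e\<in>?V. e \<in> parcs (grp_graph n r \<omega>) \<longleftrightarrow> e \<in> A} = ?E A"
      using sub that by blast
    finally show ?thesis .
  qed
  then have "(\<Union>A\<in>{A \<in> Pow ?V. Q \<lparr>pverts = {..<n}, parcs = A\<rparr>}. ?E A) \<in> sets (grp_space n p)"
    by (intro sets.finite_UN) auto
  also have "(\<Union>A\<in>{A \<in> Pow ?V. Q \<lparr>pverts = {..<n}, parcs = A\<rparr>}. ?E A) =
      {\<omega> \<in> space (grp_space n p). Q (grp_graph n r \<omega>)}"
  proof -
    have "grp_graph n r \<omega> = \<lparr>pverts = {..<n}, parcs = parcs (grp_graph n r \<omega>)\<rparr>" for \<omega>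
      by (simp add: grp_graph_def)
    then have "Q (grp_graph n r \<omega>) \<longleftrightarrow> Q \<lparr>pverts = {..<n}, parcs = parcs (grp_graph n r \<omega>)\<rparr>" for \<omega>
      by (rule arg_cong)
    then show ?thesis using sub by blast
  qed
  finally show ?thesis .
qed

section \<open>Probability of the diameter bounds\<close>

text \<open>The three error terms belong to point sets with a sparse box or a point outside the
  half-open square, to failing expansion for a good point set, and to short paths. The lower bound
  combines the geometric one with the absence of short paths.\<close>

lemma diameter_bounds_likely:
  assumes n: "n \<ge> 3" and p: "0 < p" "p \<le> 1" and r: "0 < r"
    and m: "3 / r \<le> real m" "7 \<le> m" "m\<^sup>2 \<le> n" and M: "M = real n / (4 * (real m)\<^sup>2)" "12 * ln (real n) \<le> M * p"
    and k: "4 * ln (real n) \<le> p * real k" "4 * real k \<le> M"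
    and J: "ln (real n) / p \<le> (M * p / (4 * ln (real n))) ^ J"
    and lo: "lo \<le> max (1 / (4 * r)) (real h + 1)" and hi: "2 * real J + 4 * real m + 4 \<le> hi"
  shows "1 - (real n * exp (- M) + 18 / real n + (\<Sum>l<h. real n ^ l * (16 * r\<^sup>2 * p) ^ Suc l))
    \<le> measure (grp_space n p) {\<omega> \<in> space (grp_space n p).
        ereal lo \<le> graph_diam (with_proj (grp_graph n r \<omega>)) \<and>
        graph_diam (with_proj (grp_graph n r \<omega>)) \<le> ereal hi}"
proof -
  interpret A: prob_space "point_space n" by (rule prob_space_point_space)
  interpret B: prob_space "bit_space n p" by (rule prob_space_bit_space)
  interpret P: prob_space "grp_space n p" by (rule prob_space_grp_space)
  let ?G = "\<lambda>\<omega>. graph_diam (with_proj (grp_graph n r \<omega>))"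
  let ?\<Omega> = "space (grp_space n p)"
  define Ev where "Ev = {\<omega> \<in> ?\<Omega>. ereal lo \<le> ?G \<omega> \<and> ?G \<omega> \<le> ereal hi}"
  have Ev: "Ev \<in> P.events"
    unfolding Ev_def by (rule graph_event_sets[where Q = "\<lambda>G. ereal lo \<le> graph_diam (with_proj G) \<and> graph_diam (with_proj G) \<le> ereal hi"])
  have "1 \<le> m" using m by simp
  from cells_occupied[OF this m(3)] obtain N1 where N1: "N1 \<in> A.events" "A.prob N1 \<le> real n * exp (- M)"
    and X: "\<And>X u. X \<in> space (point_space n) - N1 \<Longrightarrow> u < n \<Longrightarrow> X u \<in> {0..<1} \<times> {0..<1}"
    and cells: "\<And>X c. X \<in> space (point_space n) - N1 \<Longrightarrow> c \<in> {..<m} \<times> {..<m} \<Longrightarrow>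
      M < real (card (cell_of n m X c))"
    unfolding M(1)[symmetric] by blast
  have "2 \<le> n" "0 \<le> r" "0 \<le> p" using n r p by auto
  from short_path_unlikely[OF this p(2), of h] obtain N2 where N2: "N2 \<in> P.events"
      "P.prob N2 \<le> (\<Sum>l<h. real n ^ l * (16 * r\<^sup>2 * p) ^ Suc l)"
    and short: "\<And>\<omega> i. \<omega> \<in> ?\<Omega> - N2 \<Longrightarrow> \<forall>u<n. fst \<omega> u \<in> unit_square \<Longrightarrow>
      (0, 1) \<in> parcs (grp_graph n r \<omega>) ^^ i \<Longrightarrow> h < i"
    by blast
  have sq: "{0..<1} \<times> {0..<1} \<subseteq> unit_square" by (auto simp: unit_square_def)
  have M0: "0 \<le> M" unfolding M(1) by simp
  define F where "F = N1 \<times> space (bit_space n p)"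
  have F: "F \<in> P.events" unfolding F_def grp_space_def using N1 by (intro pair_measureI) auto
  have "emeasure (grp_space n p) F = emeasure (point_space n) N1 * emeasure (bit_space n p) (space (bit_space n p))"
    unfolding F_def grp_space_def using N1 by (intro B.emeasure_pair_measure_Times) auto
  then have F_le: "P.prob F \<le> real n * exp (- M)"
    using N1(2) by (simp add: B.emeasure_space_1 measure_def)
  \<comment> \<open>The exceptional sets of bits are obtained separately for each point set, so
    their union need not be jointly measurable. \<open>R\<close> is an event by construction, and
    each of its sections is empty or contained in one of these sets.\<close>
  define R where "R = (?\<Omega> - Ev) - (F \<union> N2)"
  have R: "R \<in> P.events" unfolding R_def using Ev F N2 by auto
  have lower: "ereal lo \<le> ?G \<omega>" if \<omega>: "\<omega> \<in> ?\<Omega>" "\<omega> \<notin> F" "\<omega> \<notin> N2" for \<omega>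
  proof -
    obtain X B where XB: "\<omega> = (X, B)" by (cases \<omega>)
    have X': "X \<in> space (point_space n) - N1"
      using \<omega>(1,2) by (auto simp: XB F_def grp_space_def space_pair_measure)
    have us: "X u \<in> unit_square" if "u < n" for u using sq X[OF X' that] by (rule subsetD)
    have "cell_of n m X c \<noteq> {}" if "c \<in> {..<m} \<times> {..<m}" for c
      using cells[OF X' that] M0 by auto
    then have "ereal (1 / (4 * r)) \<le> ?G \<omega>"
      unfolding XB using r m us by (intro graph_diam_lower_geometric[where m = m]) auto
    moreover have "ereal (real h + 1) \<le> ?G \<omega>"
    proof (rule graph_diam_ge[OF wf_digraph_grp_graph, of 0 _ _ _ 1])
      fix i assume "(0, 1) \<in> parcs (grp_graph n r \<omega>) ^^ i"
      then have "h < i" using us \<omega> by (intro short[of \<omega>]) (auto simp: XB)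
      then show "real h + 1 \<le> real i" by simp
    qed (use n in \<open>auto simp: grp_graph_def\<close>)
    ultimately have "ereal (max (1 / (4 * r)) (real h + 1)) \<le> ?G \<omega>" by (simp add: max_def)
    then show ?thesis using lo by (meson ereal_less_eq(3) order_trans)
  qed
  have sec: "B.prob (Pair X -` R) \<le> 18 / real n" if "X \<in> space (point_space n)" for X
  proof (cases "X \<in> N1")
    case True
    then have "Pair X -` R = {}" by (auto simp: R_def F_def grp_space_def space_pair_measure)
    then show ?thesis by simp
  next
    case False
    then have X': "X \<in> space (point_space n) - N1" using that by blast
    have cells': "M \<le> real (card (cell_of n m X c))" if "c \<in> {..<m} \<times> {..<m}" for c
      using cells[OF X' that] by simp
    have "2 \<le> m" using m by simp
    obtain N where N: "N \<in> B.events" "B.prob N \<le> 18 / real n"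
      and upper: "\<And>B. B \<in> space (bit_space n p) - N \<Longrightarrow> ?G (X, B) \<le> ereal (2 * real J + 4 * real m + 4)"
      using graph_diam_upper[OF n p r m(1) \<open>2 \<le> m\<close> m(3) X[OF X'] cells' M(2) k J] by blast
    have "Pair X -` R \<subseteq> N"
    proof
      fix B assume "B \<in> Pair X -` R"
      then have B: "(X, B) \<in> ?\<Omega>" "(X, B) \<notin> Ev" "(X, B) \<notin> F" "(X, B) \<notin> N2" by (auto simp: R_def)
      then have "\<not> ?G (X, B) \<le> ereal hi" using lower[of "(X, B)"] by (auto simp: Ev_def)
      moreover have "B \<in> space (bit_space n p)" using B(1) by (simp add: grp_space_def space_pair_measure)
      ultimately show "B \<in> N" using upper[of B] hi by (meson DiffI ereal_less_eq(3) order_trans)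
    qed
    then have "B.prob (Pair X -` R) \<le> B.prob N" using N(1) by (rule B.finite_measure_mono)
    then show ?thesis using N(2) by linarith
  qed
  have R_le: "P.prob R \<le> 18 / real n"
    unfolding grp_space_def
    by (rule measure_pair_section_le[OF A.prob_space_axioms B.prob_space_axioms _ _ sec])
       (use R in \<open>auto simp: grp_space_def\<close>)
  have "P.prob (?\<Omega> - Ev) \<le> P.prob ((F \<union> N2) \<union> R)"
    using Ev F N2 R by (intro P.finite_measure_mono) (auto simp: R_def)
  also have "\<dots> \<le> P.prob (F \<union> N2) + P.prob R" using F N2 R by (intro measure_Un_le) auto
  also have "P.prob (F \<union> N2) \<le> P.prob F + P.prob N2" using F N2 by (intro measure_Un_le) auto
  finally have "P.prob (?\<Omega> - Ev) \<le> real n * exp (- M) + (\<Sum>l<h. real n ^ l * (16 * r\<^sup>2 * p) ^ Suc l) + 18 / real n"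
    using F_le N2(2) R_le by linarith
  then show ?thesis
    using P.prob_compl[OF Ev] unfolding Ev_def by linarith
qed

text \<open>All parameters are chosen here. The threshold 40000 exceeds the square of 196, where
  \<open>196 = 4 * 49\<close> comes from \<open>g \<ge> D / (196 * L)\<close>.\<close>

lemma diameter_bounds_likely_large:
  assumes l: "40000 \<le> ln (real n)" and r: "0 < r" "r < 1 / 2" and p: "0 \<le> p" "p \<le> 1"
    and d: "(ln (real n))\<^sup>2 \<le> real n * r\<^sup>2 * p"
  shows "1 - (19 / real n + ln (real n) / sqrt (real n))
    \<le> measure (grp_space n p) {\<omega> \<in> space (grp_space n p).
        ereal (1 / 8 * (1 / r + ln (real n) / ln (real n * r\<^sup>2 * p)))
          \<le> graph_diam (with_proj (grp_graph n r \<omega>)) \<and>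
        graph_diam (with_proj (grp_graph n r \<omega>))
          \<le> ereal (17 * (1 / r + ln (real n) / ln (real n * r\<^sup>2 * p)))}"
proof -
  define L where "L = ln (real n)"
  define D where "D = real n * r\<^sup>2 * p"
  \<comment> \<open>The density hypothesis becomes \<open>L \<le> s\<close>, so dividing
    \<open>D\<close> by \<open>L\<close> leaves at least \<open>s\<close>.\<close>
  define s where "s = sqrt D"
  have L: "40000 \<le> L" and DL: "L\<^sup>2 \<le> D" using l d by (simp_all add: L_def D_def)
  have n3: "n \<ge> 3"
  proof (rule ccontr)
    assume "\<not> n \<ge> 3"
    then have "n = 0 \<or> n = 1 \<or> n = 2" by auto
    then show False using l ln_2_less_1 by auto
  qed
  have nL: "real n = exp L" using n3 by (simp add: L_def)
  have LL: "40000 * L \<le> L\<^sup>2" using L by (simp add: power2_eq_square)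
  have D0: "0 < D" "40000 \<le> D" "40000 * L \<le> D" using DL LL L by linarith+
  have "p \<noteq> 0" using D0(1) unfolding D_def by (intro notI) simp
  then have p0: "0 < p" using p by simp
  have pD: "p * (real n * r\<^sup>2) = D" by (simp add: D_def)
  have nr: "D \<le> real n * r\<^sup>2" using p n3 by (simp add: D_def mult_left_le)
  have s: "s\<^sup>2 = D" "L \<le> s" "0 < s"
    using D0(1) by (simp_all add: s_def real_le_rsqrt[OF DL])
  define m where "m = nat \<lceil>3 / r\<rceil>"
  have r2: "1 \<le> 1 / (2 * r)" "6 < 3 / r" using r by (simp_all add: field_simps)
  have "0 \<le> 3 / r" using r by simp
  then have m1: "3 / r \<le> real m" "real m \<le> 3 / r + 1" unfolding m_def by linarith+
  have m7: "7 \<le> m" using r2 m1 by linarith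
  \<comment> \<open>The 1 lost in rounding up is at most \<open>1 / (2 * r)\<close>.\<close>
  have m2: "real m \<le> 7 / (2 * r)" using m1 r2 r by (simp add: field_simps)
  have "(real m)\<^sup>2 \<le> (7 / (2 * r))\<^sup>2" using m2 by (intro power_mono) auto
  then have msq: "(real m)\<^sup>2 \<le> 49 / (4 * r\<^sup>2)" by (simp add: power_divide power_mult_distrib)
  have "49 / (4 * r\<^sup>2) \<le> real n" using nr D0 r by (simp add: field_simps)
  with msq have "(real m)\<^sup>2 \<le> real n" by (rule order_trans)
  then have "real (m\<^sup>2) \<le> real n" by (simp only: of_nat_power)
  then have mn: "m\<^sup>2 \<le> n" by (simp only: of_nat_le_iff)
  define M where "M = real n / (4 * (real m)\<^sup>2)"
  have "real n / (4 * (49 / (4 * r\<^sup>2))) \<le> M"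
    unfolding M_def using msq m7 r by (intro divide_left_mono mult_left_mono) auto
  then have M: "real n * r\<^sup>2 / 49 \<le> M" by simp
  have "p * (real n * r\<^sup>2 / 49) \<le> p * M" using M p by (intro mult_left_mono) auto
  then have Mp: "D / 49 \<le> M * p" using pD by (simp add: mult.commute)
  have M12: "12 * L \<le> M * p" "20 * L \<le> M * p" using Mp D0 L by linarith+
  have M0: "0 \<le> M" by (simp add: M_def)
  have "M * p \<le> M" using p M0 by (simp add: mult_left_le)
  then have M2: "2 * L \<le> M" using M12 L by linarith
  define k where "k = nat \<lceil>4 * L / p\<rceil>"
  have "0 \<le> 4 * L / p" using L p0 by simp
  then have k: "4 * L / p \<le> real k" "real k \<le> 4 * L / p + 1" unfolding k_def by linarith+
  have k1: "4 * L \<le> p * real k" using k(1) p0 by (simp add: field_simps)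
  have "1 \<le> L / p" using p0 p L by (simp add: field_simps)
  moreover have "real k \<le> 4 * (L / p) + 1" using k(2) by simp
  ultimately have "4 * real k \<le> 20 * (L / p)" by linarith
  also have "\<dots> \<le> M" using M12 p0 by (simp add: field_simps)
  finally have k2: "4 * real k \<le> M" .
  define g where "g = M * p / (4 * L)"
  \<comment> \<open>\<open>g\<close> is at least \<open>s / 196\<close>, and
    \<open>sqrt s \<ge> 196\<close> absorbs the constant. Thus \<open>g\<close> is at least the
    fourth root of \<open>D\<close>, which makes \<open>ln g\<close> comparable to
    \<open>ln D\<close>.\<close>
  have "sqrt s \<le> g"
  proof -
    have "196 \<le> sqrt s" using s L by (intro real_le_rsqrt) auto
    then have "196 * sqrt s \<le> sqrt s * sqrt s" using s by (intro mult_right_mono) auto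
    also have "\<dots> = s" using s by simp
    finally have 1: "sqrt s \<le> s / 196" by simp
    have "s * L \<le> s * s" using s by (intro mult_left_mono) auto
    then have "s * L \<le> D" by (metis power2_eq_square s(1))
    then have "s / 196 * (4 * L) \<le> M * p" using Mp by linarith
    moreover have "0 < 4 * L" using L by simp
    ultimately have "s / 196 \<le> g" unfolding g_def by (simp only: pos_le_divide_eq)
    with 1 show ?thesis by linarith
  qed
  then have "ln (sqrt s) \<le> ln g" using s by (intro ln_mono) auto
  moreover have "ln (sqrt s) = ln D / 4"
    using s D0 by (simp add: ln_sqrt s_def)
  ultimately have lng: "ln D / 4 \<le> ln g" by simp
  have lnD: "1 \<le> ln D" using D0 exp_le by (subst ln_ge_iff) auto
  have g0: "0 < g" using \<open>sqrt s \<le> g\<close> s by (metis less_le_trans real_sqrt_gt_zero)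
  \<comment> \<open>This gives \<open>g ^ J \<ge> n\<close>, which is enough since
    \<open>L \<le> D \<le> p * n\<close> yields \<open>L / p \<le> n\<close>.\<close>
  define J where "J = nat \<lceil>L / ln g\<rceil>"
  have "0 \<le> L / ln g" using L lng lnD by (intro divide_nonneg_nonneg) linarith+
  then have J: "L / ln g \<le> real J" "real J \<le> L / ln g + 1" unfolding J_def by linarith+
  have "L / ln g \<le> L / (ln D / 4)" using L lng lnD by (intro divide_left_mono) auto
  also have "L / (ln D / 4) = 4 * (L / ln D)" by simp
  finally have J2: "real J \<le> 4 * (L / ln D) + 1" using J(2) by linarith
  have "L \<le> real J * ln g" using J(1) lng lnD by (simp add: pos_divide_le_eq)
  then have "exp L \<le> exp (ln g) ^ J" by (simp flip: exp_of_nat_mult)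
  then have gJ: "real n \<le> g ^ J" using g0 nL by simp
  have "L / p \<le> real n"
  proof -
    have "L \<le> D" using D0 L by linarith
    also have "D \<le> p * real n"
    proof -
      have "r\<^sup>2 \<le> 1" using r by (simp add: power_le_one)
      then have "real n * r\<^sup>2 \<le> real n * 1" by (intro mult_left_mono) auto
      then show ?thesis using p pD by (metis mult.right_neutral mult_left_mono)
    qed
    finally show ?thesis using p0 by (simp add: field_simps)
  qed
  with gJ have J1: "L / p \<le> (M * p / (4 * L)) ^ J" unfolding g_def by linarith
  \<comment> \<open>Chosen so that \<open>(16 * D) ^ h \<le> sqrt n\<close>. Each of the at most
    \<open>L\<close> terms of the path sum is then at most \<open>1 / sqrt n\<close>.\<close>
  define h where "h = nat \<lfloor>L / (2 * ln (16 * D))\<rfloor>"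
  have ln16: "ln (16 * D) \<le> 2 * ln D" "1 \<le> ln (16 * D)"
  proof -
    have "ln (16 * D) \<le> ln (D * D)" using D0 by (intro ln_mono mult_right_mono) auto
    then show "ln (16 * D) \<le> 2 * ln D" using D0 by (simp add: ln_mult)
    have "ln D \<le> ln (16 * D)" using D0 by (intro ln_mono) auto
    then show "1 \<le> ln (16 * D)" using lnD by linarith
  qed
  have "0 \<le> L / (2 * ln (16 * D))" using L ln16 by simp
  then have h: "real h \<le> L / (2 * ln (16 * D))" "L / (2 * ln (16 * D)) \<le> real h + 1" unfolding h_def by linarith+
  have "L / (4 * ln D) \<le> L / (2 * ln (16 * D))" using L ln16 lnD by (intro divide_left_mono) auto
  then have h1: "L / (4 * ln D) \<le> real h + 1" using h by linarith
  have "L / (2 * ln (16 * D)) \<le> L / 1" using L ln16 by (intro divide_left_mono) auto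
  then have hL: "real h \<le> L" using h by linarith
  \<comment> \<open>The left side is the average of \<open>1 / (4 * r)\<close> and
    \<open>L / (4 * ln D)\<close>.\<close>
  have lo: "1 / 8 * (1 / r + L / ln D) \<le> max (1 / (4 * r)) (real h + 1)"
  proof -
    have "1 / 8 * (1 / r + L / ln D) = (1 / (4 * r) + L / (4 * ln D)) / 2" by (simp add: field_simps)
    also have "(a + b) / 2 \<le> max a b'" if "b \<le> b'" for a b b' :: real
      using that by (cases "a \<le> b'") (simp_all add: max_def)
    note this[OF h1]
    finally show ?thesis .
  qed
  \<comment> \<open>The boxes contribute \<open>14 / r\<close>, and the additive constant
    \<open>2 + 4\<close> is at most \<open>3 / r\<close>, which gives the 17; the term
    \<open>2 * J\<close> adds at most 8 times \<open>L / ln D\<close>.\<close>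
  have hi: "2 * real J + 4 * real m + 4 \<le> 17 * (1 / r + L / ln D)"
  proof -
    have "4 * real m \<le> 14 * (1 / r)" using m2 by (simp add: field_simps)
    moreover have "2 \<le> 1 / r" using r by (simp add: field_simps)
    moreover have "0 \<le> L / ln D" using L lnD by simp
    ultimately show ?thesis using J2 by argo
  qed
  have "real n * exp (- M) \<le> real n * exp (- (2 * L))" using M2 by (intro mult_left_mono) auto
  also have "\<dots> = 1 / real n" proof -
    have "exp L * exp (- (2 * L)) = exp (- L)" by (simp flip: exp_add)
    then show ?thesis by (simp add: nL exp_minus inverse_eq_divide)
  qed
  finally have e1: "real n * exp (- M) \<le> 1 / real n" .
  have e3: "(\<Sum>l<h. real n ^ l * (16 * r\<^sup>2 * p) ^ Suc l) \<le> L / sqrt (real n)"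
  proof -
    have "real h * ln (16 * D) \<le> L / (2 * ln (16 * D)) * ln (16 * D)"
      using h ln16 by (intro mult_right_mono) auto
    also have "\<dots> = L / 2" using ln16 by simp
    finally have "exp (real h * ln (16 * D)) \<le> exp (L / 2)" by simp
    moreover have "exp (real h * ln (16 * D)) = (16 * D) ^ h" using D0 by (simp add: exp_of_nat_mult)
    moreover have "exp (L / 2) = sqrt (real n)"
      unfolding nL by (rule real_sqrt_unique[symmetric]) (simp_all flip: exp_double)
    ultimately have pow: "(16 * D) ^ h \<le> sqrt (real n)" by simp
    have "real n ^ l * (16 * r\<^sup>2 * p) ^ Suc l \<le> 1 / sqrt (real n)" if "l < h" for l
    proof -
      have "real n * (real n ^ l * (16 * r\<^sup>2 * p) ^ Suc l) = (real n * (16 * r\<^sup>2 * p)) ^ Suc l"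
        by (simp add: power_mult_distrib)
      also have "real n * (16 * r\<^sup>2 * p) = 16 * D" by (simp add: D_def)
      finally have "real n ^ l * (16 * r\<^sup>2 * p) ^ Suc l = (16 * D) ^ Suc l / real n"
        using n3 by (simp add: eq_divide_eq mult.commute)
      also have "\<dots> \<le> (16 * D) ^ h / real n"
        using that D0 by (intro divide_right_mono power_increasing) auto
      also have "\<dots> \<le> sqrt (real n) / real n" using pow by (intro divide_right_mono) auto
      also have "\<dots> = 1 / sqrt (real n)" using n3 by (simp add: field_simps)
      finally show ?thesis .
    qed
    then have "(\<Sum>l<h. real n ^ l * (16 * r\<^sup>2 * p) ^ Suc l) \<le> (\<Sum>l<h. 1 / sqrt (real n))"
      by (intro sum_mono) auto
    also have "\<dots> = real h / sqrt (real n)" by simp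
    also have "\<dots> \<le> L / sqrt (real n)" using hL by (intro divide_right_mono) auto
    finally show ?thesis .
  qed
  have "1 - (19 / real n + L / sqrt (real n)) \<le>
      1 - (real n * exp (- M) + 18 / real n + (\<Sum>l<h. real n ^ l * (16 * r\<^sup>2 * p) ^ Suc l))"
    using e1 e3 by (simp add: field_simps)
  also have "\<dots> \<le> measure (grp_space n p) {\<omega> \<in> space (grp_space n p).
        ereal (1 / 8 * (1 / r + L / ln D)) \<le> graph_diam (with_proj (grp_graph n r \<omega>)) \<and>
        graph_diam (with_proj (grp_graph n r \<omega>)) \<le> ereal (17 * (1 / r + L / ln D))}"
    by (rule diameter_bounds_likely[OF n3 p0 p(2) r(1) m1(1) m7 mn M_def _ _ k2 _ lo hi])
       (use M12 k1 J1 in \<open>simp_all add: L_def\<close>)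
  finally show ?thesis unfolding L_def D_def .
qed

text \<open>The error in \<open>diameter_bounds_likely_large\<close> depends on \<open>n\<close>
  alone and tends to 0, so the constants 1/8 and 17 serve all sequences \<open>r\<close> and
  \<open>p\<close>, and the probability is squeezed to 1.\<close>

theorem theorem6:
  shows "\<exists>c C :: real. 0 < c \<and> 0 < C \<and>
    (\<forall>r p :: nat \<Rightarrow> real.
      (\<forall>\<^sub>F n in sequentially.
         0 < r n \<and> r n < 1 / 2 \<and> 0 \<le> p n \<and> p n \<le> 1 \<and>
         real n * (r n)\<^sup>2 * p n \<ge> (ln (real n))\<^sup>2) \<longrightarrow>
      (\<lambda>n. measure (grp_space n (p n))
         {\<omega> \<in> space (grp_space n (p n)).
            ereal (c * (1 / r n + ln (real n) / ln (real n * (r n)\<^sup>2 * p n)))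
              \<le> graph_diam (with_proj (grp_graph n (r n) \<omega>)) \<and>
            graph_diam (with_proj (grp_graph n (r n) \<omega>))
              \<le> ereal (C * (1 / r n + ln (real n) / ln (real n * (r n)\<^sup>2 * p n)))})
        \<longlonglongrightarrow> 1)"
proof (rule exI[of _ "1 / 8"], rule exI[of _ 17], intro conjI allI impI)
  fix r p :: "nat \<Rightarrow> real"
  assume *: "\<forall>\<^sub>F n in sequentially.
         0 < r n \<and> r n < 1 / 2 \<and> 0 \<le> p n \<and> p n \<le> 1 \<and>
         real n * (r n)\<^sup>2 * p n \<ge> (ln (real n))\<^sup>2"
  let ?f = "\<lambda>n. measure (grp_space n (p n))
         {\<omega> \<in> space (grp_space n (p n)).
            ereal (1 / 8 * (1 / r n + ln (real n) / ln (real n * (r n)\<^sup>2 * p n)))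
              \<le> graph_diam (with_proj (grp_graph n (r n) \<omega>)) \<and>
            graph_diam (with_proj (grp_graph n (r n) \<omega>))
              \<le> ereal (17 * (1 / r n + ln (real n) / ln (real n * (r n)\<^sup>2 * p n)))}"
  have lim: "(\<lambda>n. 1 - (19 / real n + ln (real n) / sqrt (real n))) \<longlonglongrightarrow> 1"
    by real_asymp
  have "filterlim (\<lambda>n. ln (real n)) at_top sequentially" by real_asymp
  then have "\<forall>\<^sub>F n in sequentially. 40000 \<le> ln (real n)"
    by (simp add: filterlim_at_top)
  with * have ge: "\<forall>\<^sub>F n in sequentially. 1 - (19 / real n + ln (real n) / sqrt (real n)) \<le> ?f n"
    by eventually_elim (rule diameter_bounds_likely_large; blast)
  have le: "\<forall>\<^sub>F n in sequentially. ?f n \<le> 1"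
    by (intro always_eventually allI prob_space.prob_le_1 prob_space_grp_space)
  show "?f \<longlonglongrightarrow> 1"
    by (rule tendsto_sandwich[OF ge le lim tendsto_const])
qed auto

end
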